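(* Let $N\ge 1$, let $A\in\mathbb{R}_+^{N\times N}$ be a symmetric entrywise non-negative matrix with spectral radius $\rho(A)<1$, let $\sigma>0$, and let $(\mathbf{y}(n))_{n\in\mathbb{N}}$ be the $\mathbb{R}^N$-valued process defined by $$\mathbf{y}(n+1)=A\mathbf{y}(n)+\mathbf{x}(n+1),\qquad n\in\mathbb{N},$$ where the noise vectors $\mathbf{x}(n)\sim\mathcal{N}(0,\sigma^2 I_N)$ are independent across time $n$. Let $S\subset\{1,\dots,N\}$ be a nonempty set of observed nodes. Let $D\le 1$ and $L\ge 3$ be integers, put $M=L-D+1$, and for each pair $i,j\in S$ with $i\ne j$ define the feature vector $$\mathcal{T}^{(n)}_{ij}:=\left([\widehat{R}_D(n)]_{ij},[\widehat{R}_{D+1}(n)]_{ij},\ldots,[\widehat{R}_L(n)]_{ij}\right)\in\mathbb{R}^M .$$ Then the set of features $\{\mathcal{T}^{(n)}_{ij}\}_{i\neq j}$ is consistently linearly separable with high probability; that is, there exists an affine map $\mathcal{L}:\mathbb{R}^M\to\mathbb{R}$ (not depending on $n$) such that for all $i,j\in S$ with $i\neq j$, $$\mathbb{P}\left(\mathcal{L}(\mathcal{T}^{(n)}_{ij})>0\right)\xrightarrow[n\to\infty]{}1\ \text{ if } A_{ij}\neq 0,\qquad \mathbb{P}\left(\mathcal{L}(\mathcal{T}^{(n)}_{ij})\le 0\right)\xrightarrow[n\to\infty]{}1\ \text{ if } A_{ij}=0 .$$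
   Context: $\mathbb{N}=\{0,1,2,\ldots\}$. The initial state $\mathbf{y}(0)$ is an arbitrary $\mathbb{R}^N$-valued random vector. For an integer $k\ge 0$ the empirical $k$-th lag covariance matrix is $$\widehat{R}_k(n):=\frac1n\sum_{\ell=0}^{n-1}\mathbf{y}(\ell+k)\,\mathbf{y}(\ell)^\top,\qquad n\ge 1,$$ and for $k<0$ we use the convention $\widehat{R}_k(n):=\widehat{R}_{-k}(n)^\top$. The entry $[\widehat{R}_k(n)]_{ij}$ is indexed by the original node labels $i,j\in\{1,\dots,N\}$. A pair $ij$ with $i\ne j$ is called connected if $A_{ij}\neq 0$ and disconnected if $A_{ij}=0$. *)

theory Defs
  imports "HOL-Probability.Probability"
begin

definition spectrum :: "real^'n^'n \<Rightarrow> complex set" where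
  "spectrum A = {z. \<exists>v. v \<noteq> 0 \<and> map_matrix complex_of_real A *v v = z *s v}"

definition spectral_radius :: "real^'n^'n \<Rightarrow> real" where
  "spectral_radius A = (SUP z \<in> spectrum A. cmod z)"

(* Density of N(mu, Sigma) with respect to Lebesgue measure; meaningful for
   symmetric positive definite Sigma. *)
definition mvn_density :: "real^'n \<Rightarrow> real^'n^'n \<Rightarrow> real^'n \<Rightarrow> real" where
  "mvn_density \<mu> \<Sigma> v =
     exp (- ((v - \<mu>) \<bullet> (matrix_inv \<Sigma> *v (v - \<mu>))) / 2) / sqrt ((2 * pi) ^ CARD('n) * det \<Sigma>)"

definition (in prob_space) multivariate_normal ::
    "('a \<Rightarrow> real^'n) \<Rightarrow> real^'n \<Rightarrow> real^'n^'n \<Rightarrow> bool" where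
  "multivariate_normal X \<mu> \<Sigma> \<longleftrightarrow> distributed M lborel X (\<lambda>v. ennreal (mvn_density \<mu> \<Sigma> v))"

definition outer_product :: "real^'n \<Rightarrow> real^'n \<Rightarrow> real^'n^'n" where
  "outer_product u v = (\<chi> i j. u $ i * v $ j)"

(* Applied to one trajectory y of the process. At n = 0 the value is the zero matrix. *)
definition lag_cov :: "(nat \<Rightarrow> real^'n) \<Rightarrow> int \<Rightarrow> nat \<Rightarrow> real^'n^'n" where
  "lag_cov y k n =
     (let R = (\<lambda>p::nat. (1 / real n) *\<^sub>R (\<Sum>l<n. outer_product (y (l + p)) (y l)))
      in if 0 \<le> k then R (nat k) else transpose (R (nat (- k))))"

(* The vector (R_D, ..., R_L)_{ij}: the finite linear order 'm has L - D + 1 elements, and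
   card {..<m} is the zero-based position of the coordinate m. *)
definition feature ::
    "int \<Rightarrow> (nat \<Rightarrow> real^'n) \<Rightarrow> nat \<Rightarrow> 'n \<Rightarrow> 'n \<Rightarrow> real^('m::{finite,linorder})" where
  "feature D y n i j = (\<chi> m. lag_cov y (D + int (card {..<m})) n $ i $ j)"

definition affine_map :: "('a::real_vector \<Rightarrow> 'b::real_vector) \<Rightarrow> bool" where
  "affine_map f \<longleftrightarrow> (\<exists>g c. linear g \<and> (\<forall>t. f t = g t + c))"

end

theory Submission
  imports Defs
begin

text \<open>
  The affine map is the difference of the lag-one and lag-three entries minus a threshold, because
  \<open>R\<^sub>1(n) - R\<^sub>3(n)\<close> converges in probability to \<open>\<sigma>\<^sup>2 A\<close>: in the limit \<open>R\<^sub>k = A\<^sup>k R\<^sub>0\<close> and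
  \<open>(I - A\<^sup>2) R\<^sub>0 = \<sigma>\<^sup>2 I\<close>. The threshold lies strictly between zero and the least nonzero entry
  of \<open>\<sigma>\<^sup>2 A\<close>.

  For the convergence, averages of noise against the past state vanish since their summands are
  orthogonal in \<open>L\<^sup>2\<close>, and telescoping \<open>y(l) y(l)\<^sup>T\<close> shows that \<open>P - A P A - \<sigma>\<^sup>2 I\<close> vanishes for
  \<open>P = R\<^sub>0(n)\<close>. As \<open>A\<close> is symmetric, its operator norm is at most its spectral radius, hence less
  than one, and this gives \<open>A P - A\<^sup>3 P \<rightarrow> \<sigma>\<^sup>2 A\<close>. The arbitrary initial state contributes only
  \<open>A\<^sup>l y(0)\<close>, whose effect on the averages is a fixed random variable times a vanishing one.
\<close>

section \<open>Symmetric matrices\<close>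

lemma symmetric_inner:
  fixes A :: "real^'n^'n"
  assumes "transpose A = A"
  shows "(A *v u) \<bullet> v = u \<bullet> (A *v v)"
  using assms by (metis dot_lmul_matrix inner_commute transpose_matrix_vector)

text \<open>Evaluate the eigenvalue equation at a coordinate where the eigenvector has maximal
  modulus. The point is that the spectrum is bounded, so that the supremum defining
  \<open>spectral_radius\<close> is a genuine upper bound.\<close>

lemma cmod_spectrum_le:
  fixes A :: "real^'n^'n"
  assumes "z \<in> spectrum A"
  shows "cmod z \<le> (\<Sum>i\<in>UNIV. \<Sum>j\<in>UNIV. \<bar>A $ i $ j\<bar>)"
proof -
  obtain v where v: "v \<noteq> 0" "map_matrix complex_of_real A *v v = z *s v"
    using assms unfolding spectrum_def by blast
  let ?R = "range (\<lambda>j. cmod (v $ j))"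
  have "Max ?R \<in> ?R" by (intro Max_in) auto
  then obtain k where "Max ?R = cmod (v $ k)" by blast
  hence k: "cmod (v $ j) \<le> cmod (v $ k)" for j
    using Max_ge[of ?R "cmod (v $ j)"] by auto
  obtain j where "v $ j \<noteq> 0" using v(1) by (metis vec_eq_iff zero_index)
  hence pos: "cmod (v $ k) > 0" using k[of j] by (meson order_less_le_trans zero_less_norm_iff)
  have "z * v $ k = (\<Sum>j\<in>UNIV. complex_of_real (A $ k $ j) * v $ j)"
    using arg_cong[OF v(2), of "\<lambda>u. u $ k"]
    by (simp add: matrix_vector_mult_def map_matrix_def)
  hence "cmod z * cmod (v $ k) = cmod (\<Sum>j\<in>UNIV. complex_of_real (A $ k $ j) * v $ j)"
    by (metis norm_mult)
  also have "\<dots> \<le> (\<Sum>j\<in>UNIV. \<bar>A $ k $ j\<bar> * cmod (v $ k))"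
    by (intro sum_norm_le) (simp add: norm_mult mult_left_mono k)
  also have "\<dots> = (\<Sum>j\<in>UNIV. \<bar>A $ k $ j\<bar>) * cmod (v $ k)"
    by (simp add: sum_distrib_right)
  finally have "cmod z \<le> (\<Sum>j\<in>UNIV. \<bar>A $ k $ j\<bar>)" using pos by simp
  also have "\<dots> \<le> (\<Sum>i\<in>UNIV. \<Sum>j\<in>UNIV. \<bar>A $ i $ j\<bar>)"
    by (rule member_le_sum) (auto intro: sum_nonneg)
  finally show ?thesis .
qed

lemma real_eigenvalue_le_spectral_radius:
  fixes A :: "real^'n^'n"
  assumes "A *v v = c *\<^sub>R v" "v \<noteq> 0"
  shows "\<bar>c\<bar> \<le> spectral_radius A"
proof -
  define w :: "complex^'n" where "w = (\<chi> i. complex_of_real (v $ i))"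
  have "w \<noteq> 0" using assms(2) by (auto simp: w_def vec_eq_iff)
  moreover have "map_matrix complex_of_real A *v w = complex_of_real c *s w"
  proof (rule vec_eq_iff[THEN iffD2], rule allI)
    fix i
    have "(map_matrix complex_of_real A *v w) $ i = complex_of_real ((A *v v) $ i)"
      by (simp add: matrix_vector_mult_def map_matrix_def w_def)
    also have "\<dots> = (complex_of_real c *s w) $ i"
      by (simp add: assms(1) w_def)
    finally show "(map_matrix complex_of_real A *v w) $ i = (complex_of_real c *s w) $ i" .
  qed
  ultimately have "complex_of_real c \<in> spectrum A"
    unfolding spectrum_def by blast
  moreover have "bdd_above (cmod ` spectrum A)"
    using cmod_spectrum_le by (auto simp: bdd_above_def)
  ultimately have "cmod (complex_of_real c) \<le> spectral_radius A"
    unfolding spectral_radius_def by (rule cSUP_upper)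
  thus ?thesis by simp
qed

text \<open>A unit vector \<open>v\<close> at which \<open>norm (A *v v)\<close> is maximal
  satisfies \<open>A *v (A *v v) = ?a\<^sup>2 *\<^sub>R v\<close>, by the equality case of the
  Cauchy-Schwarz inequality. Factoring \<open>A\<^sup>2 - a\<^sup>2\<close> shows that
  \<open>a\<close> or \<open>-a\<close> is an eigenvalue of \<open>A\<close>, so no spectral theorem
  enters.\<close>

lemma symmetric_onorm_le_spectral_radius:
  fixes A :: "real^'n^'n"
  assumes "transpose A = A"
  shows "onorm ((*v) A) \<le> spectral_radius A"
proof -
  let ?a = "onorm ((*v) A)"
  have bl: "bounded_linear ((*v) A)" by (rule matrix_vector_mul_bounded_linear)
  have le: "norm (A *v u) \<le> ?a * norm u" for u by (rule onorm[OF bl])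
  have "compact (sphere (0::real^'n) 1)" "sphere (0::real^'n) 1 \<noteq> {}" by auto
  moreover have "continuous_on (sphere 0 1) (\<lambda>u. norm (A *v u))"
    by (intro continuous_intros matrix_vector_mult_linear_continuous_on)
  ultimately obtain v where v: "norm v = 1" "\<And>u. norm u = 1 \<Longrightarrow> norm (A *v u) \<le> norm (A *v v)"
    using continuous_attains_sup[of "sphere (0::real^'n) 1" "\<lambda>u. norm (A *v u)"] by auto
  have "?a \<le> norm (A *v v)"
  proof (rule onorm_bound)
    fix u
    show "norm (A *v u) \<le> norm (A *v v) * norm u"
    proof (cases "u = 0")
      case False
      have "norm (A *v (u /\<^sub>R norm u)) \<le> norm (A *v v)" using False by (intro v(2)) simp
      thus ?thesis using False
        by (simp add: matrix_vector_mult_scaleR divide_simps mult.commute)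
    qed simp
  qed simp
  with le[of v] v(1) have a: "norm (A *v v) = ?a" by simp
  have a0: "0 \<le> ?a" by (rule onorm_pos_le[OF bl])
  have "norm (A *v (A *v v)) \<le> ?a\<^sup>2" using le[of "A *v v"] a by (simp add: power2_eq_square)
  hence "(norm (A *v (A *v v)))\<^sup>2 \<le> (?a\<^sup>2)\<^sup>2" by (intro power_mono) auto
  moreover have "(A *v (A *v v)) \<bullet> v = ?a\<^sup>2"
    by (simp add: symmetric_inner[OF assms] a flip: power2_norm_eq_inner)
  \<comment> \<open>Expanding the square gives at most \<open>a^4 - 2 * a^4 + a^4\<close>, where the
    mixed term uses \<open>(A *v (A *v v)) \<bullet> v = ?a\<^sup>2\<close>.\<close>
  ultimately have "(norm (A *v (A *v v) - ?a\<^sup>2 *\<^sub>R v))\<^sup>2 \<le> 0"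
    unfolding power2_norm_eq_inner using v(1)
    by (simp add: inner_diff_left inner_diff_right inner_commute norm_eq_1 power2_eq_square)
  hence AA: "A *v (A *v v) = ?a\<^sup>2 *\<^sub>R v" by simp
  show ?thesis
  \<comment> \<open>Since (A - a)(A + a)v = 0, either (A + a)v is zero and \<open>v\<close> has
    eigenvalue \<open>-a\<close>, or it is itself an eigenvector for \<open>a\<close>.\<close>
  proof (cases "A *v v + ?a *\<^sub>R v = 0")
    case True
    hence "A *v v = (- ?a) *\<^sub>R v" by (simp add: add_eq_0_iff2)
    moreover have "v \<noteq> 0" using v(1) by auto
    ultimately show ?thesis using real_eigenvalue_le_spectral_radius[of A v "- ?a"] by linarith
  next
    case False
    have "A *v (A *v v + ?a *\<^sub>R v) = ?a *\<^sub>R (A *v v + ?a *\<^sub>R v)"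
      by (simp add: matrix_vector_right_distrib matrix_vector_mult_scaleR AA
          scaleR_add_right power2_eq_square)
    from real_eigenvalue_le_spectral_radius[OF this False] show ?thesis by auto
  qed
qed

section \<open>Frobenius norm of products with a symmetric matrix\<close>

lemma norm_transpose_matrix: "norm (transpose X) = norm (X :: real^'n^'m)"
proof -
  have "(norm (transpose X))\<^sup>2 = (norm X)\<^sup>2"
    unfolding power2_norm_eq_inner inner_vec_def transpose_def
    by simp (rule sum.swap)
  thus ?thesis by simp
qed

text \<open>The norm of a matrix here is the Euclidean norm of its rows' norms. By symmetry of
  \<open>A\<close>, the rows of \<open>X ** A\<close> are the images under \<open>A\<close> of the
  rows of \<open>X\<close>, so the operator norm applies row by row.\<close>

lemma norm_matrix_mult_right_le:
  fixes X :: "real^'n^'m" and A :: "real^'n^'n"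
  assumes "transpose A = A"
  shows "norm (X ** A) \<le> onorm ((*v) A) * norm X"
proof -
  have row: "(X ** A) $ i = A *v (X $ i)" for i
  proof -
    have "(X ** A) $ i = (X ** transpose A) $ i" by (simp add: assms)
    thus ?thesis
      by (simp add: matrix_matrix_mult_def matrix_vector_mult_def transpose_def vec_eq_iff mult.commute)
  qed
  have "norm (X ** A) \<le> L2_set (\<lambda>i. onorm ((*v) A) * norm (X $ i)) UNIV"
    unfolding norm_vec_def[of "X ** A"] row
    by (intro L2_set_mono onorm matrix_vector_mul_bounded_linear) auto
  also have "\<dots> = onorm ((*v) A) * norm X"
    unfolding norm_vec_def[of X]
    by (intro L2_set_right_distrib[symmetric] onorm_pos_le matrix_vector_mul_bounded_linear)
  finally show ?thesis .
qed

lemma norm_matrix_mult_left_le: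
  fixes X :: "real^'m^'n" and A :: "real^'n^'n"
  assumes "transpose A = A"
  shows "norm (A ** X) \<le> onorm ((*v) A) * norm X"
  using norm_matrix_mult_right_le[OF assms, of "transpose X"]
  by (metis assms matrix_transpose_mul norm_transpose_matrix)

lemma linear_matrix_mult_left: "linear (\<lambda>X :: real^'n^'m. A ** X)"
  by (rule linearI) (simp_all add: matrix_matrix_mult_def vec_eq_iff algebra_simps
      sum.distrib sum_distrib_left)

lemma linear_matrix_mult_right: "linear (\<lambda>X :: real^'n^'m. X ** A)"
  by (rule linearI) (simp_all add: matrix_matrix_mult_def vec_eq_iff algebra_simps
      sum.distrib sum_distrib_left)

text \<open>The commutator \<open>K = PA - AP\<close> satisfies \<open>K - AKA = EA - AE\<close>, so it is small with \<open>E\<close>;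
  replacing \<open>AP\<close> by \<open>PA - K\<close> in \<open>P - A(AP)\<close> then produces \<open>P - APA\<close>.\<close>

lemma stein_perturbation:
  fixes A P :: "real^'n^'n"
  assumes sym: "transpose A = A" and a: "onorm ((*v) A) < 1"
    and E: "E = P - A ** P ** A - s *\<^sub>R mat 1"
  shows "norm (A ** P - A ** (A ** (A ** P)) - s *\<^sub>R A)
    \<le> (1 + 2 / (1 - (onorm ((*v) A))\<^sup>2)) * norm E"
proof -
  let ?a = "onorm ((*v) A)"
  have a0: "0 \<le> ?a" by (rule onorm_pos_le[OF matrix_vector_mul_bounded_linear])
  have aa: "?a\<^sup>2 < 1" using a a0 by (simp add: power_less_one_iff)
  note L = norm_matrix_mult_left_le[OF sym] and R = norm_matrix_mult_right_le[OF sym]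
  have L1: "norm (A ** X) \<le> norm X" for X :: "real^'n^'n"
    using L[of X] mult_right_mono[of ?a 1 "norm X"] a by simp
  have R1: "norm (X ** A) \<le> norm X" for X :: "real^'n^'n"
    using R[of X] mult_right_mono[of ?a 1 "norm X"] a by simp
  note ml = linear_diff[OF linear_matrix_mult_left] linear_add[OF linear_matrix_mult_left]
    linear_scale[OF linear_matrix_mult_left]
  note mr = linear_diff[OF linear_matrix_mult_right] linear_add[OF linear_matrix_mult_right]
    linear_scale[OF linear_matrix_mult_right]
  define K where "K = P ** A - A ** P"
  have "K = A ** K ** A + (E ** A - A ** E)"
    by (simp add: K_def E ml mr matrix_mul_assoc)
  hence "norm K \<le> norm (A ** K ** A) + norm (E ** A - A ** E)"
    by (metis norm_triangle_ineq)
  also have "norm (A ** K ** A) \<le> ?a\<^sup>2 * norm K"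
    using R[of "A ** K"] mult_left_mono[OF L[of K] a0] by (simp add: power2_eq_square)
  also have "norm (E ** A - A ** E) \<le> 2 * norm E"
    using norm_triangle_ineq4[of "E ** A" "A ** E"] L1[of E] R1[of E] by simp
  finally have "(1 - ?a\<^sup>2) * norm K \<le> 2 * norm E" by (simp add: algebra_simps)
  hence K: "norm K \<le> 2 / (1 - ?a\<^sup>2) * norm E" using aa by (simp add: field_simps)
  have "A ** P - A ** (A ** (A ** P)) - s *\<^sub>R A = A ** (E + A ** K)"
    by (simp add: K_def E ml mr matrix_mul_assoc linear_neg[OF linear_matrix_mult_left])
  also have "norm \<dots> \<le> norm E + norm K"
    using L1[of "E + A ** K"] norm_triangle_ineq[of E "A ** K"] L1[of K] by linarith
  finally show ?thesis using K by (simp add: algebra_simps)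
qed

section \<open>Outer products and the positions of feature coordinates\<close>

lemma norm_outer_product: "norm (outer_product u v) = norm u * norm v"
proof -
  have "outer_product u v $ i = (u $ i) *\<^sub>R v" for i
    by (simp add: outer_product_def vec_eq_iff)
  hence "norm (outer_product u v) = L2_set (\<lambda>i. norm v * \<bar>u $ i\<bar>) UNIV"
    by (simp add: norm_vec_def[of "outer_product u v"] mult.commute)
  thus ?thesis
    by (simp add: norm_vec_def[of u] L2_set_right_distrib[symmetric] mult.commute)
qed

lemma outer_product_add_left: "outer_product (u + u') v = outer_product u v + outer_product u' v"
  by (simp add: outer_product_def vec_eq_iff algebra_simps)

lemma outer_product_add_right: "outer_product u (v + v') = outer_product u v + outer_product u v'"
  by (simp add: outer_product_def vec_eq_iff algebra_simps)

lemma outer_product_matrix_left: "outer_product (A *v u) v = A ** outer_product u v"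
  by (simp add: outer_product_def vec_eq_iff matrix_vector_mult_def matrix_matrix_mult_def
      sum_distrib_left sum_distrib_right ac_simps)

lemma outer_product_matrix_right: "outer_product u (A *v v) = outer_product u v ** transpose A"
  by (simp add: outer_product_def vec_eq_iff matrix_vector_mult_def matrix_matrix_mult_def
      transpose_def sum_distrib_left sum_distrib_right ac_simps)

text \<open>The position map is strictly increasing, hence injective, so its CARD('m) values fill
  \<open>{..<CARD('m)}\<close>. This locates the feature coordinate that holds a prescribed
  lag.\<close>

lemma ex_card_lessThan:
  assumes "k < CARD('m::{finite,linorder})"
  shows "\<exists>m::'m. card {..<m} = k"
proof -
  have mono: "card {..<m} < card {..<m'}" if "m < m'" for m m' :: 'm
    using that by (intro psubset_card_mono) auto
  have "inj (\<lambda>m::'m. card {..<m})"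
    by (rule linorder_injI) (use mono in force)
  moreover have "card {..<m} < CARD('m)" for m :: 'm
    by (intro psubset_card_mono) auto
  hence "range (\<lambda>m::'m. card {..<m}) \<subseteq> {..<CARD('m)}" by auto
  ultimately have "range (\<lambda>m::'m. card {..<m}) = {..<CARD('m)}"
    by (intro card_subset_eq) (simp_all add: card_image)
  with assms show ?thesis by (metis lessThan_iff imageE)
qed

section \<open>Moments of isotropic normal vectors\<close>

text \<open>Lebesgue measure on a Euclidean space is the image of the product of one-dimensional
  Lebesgue measures under \<open>?T\<close>, which reduces both claims to Fubini for products of
  one-variable functions.\<close>

lemma
  fixes f :: "'b::euclidean_space \<Rightarrow> real \<Rightarrow> real"
  assumes f: "\<And>b. b \<in> Basis \<Longrightarrow> integrable lborel (f b)"
  shows integrable_lborel_prod_Basis: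
      "integrable lborel (\<lambda>v. \<Prod>b\<in>Basis. f b (v \<bullet> b))" (is ?int)
    and integral_lborel_prod_Basis:
      "(\<integral>v. (\<Prod>b\<in>Basis. f b (v \<bullet> b)) \<partial>(lborel :: 'b measure)) = (\<Prod>b\<in>Basis. integral\<^sup>L lborel (f b))" (is ?eq)
proof -
  interpret product_sigma_finite "\<lambda>_::'b. lborel :: real measure" ..
  let ?T = "\<lambda>g. \<Sum>b\<in>(Basis::'b set). g b *\<^sub>R b"
  have [measurable]: "f b \<in> borel_measurable borel" if "b \<in> Basis" for b
    using borel_measurable_integrable[OF f[OF that]] by simp
  have T: "?T \<in> measurable (Pi\<^sub>M Basis (\<lambda>_. lborel)) borel" by measurable
  have F: "(\<lambda>v::'b. \<Prod>b\<in>Basis. f b (v \<bullet> b)) \<in> borel_measurable borel" by measurable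
  have FT: "(\<Prod>b\<in>Basis. f b (?T g \<bullet> b)) = (\<Prod>b\<in>Basis. f b (g b))" for g
    by (intro prod.cong) simp_all
  show ?int
    by (subst lborel_eq, subst integrable_distr_eq[OF T F])
      (unfold FT, intro product_integrable_prod, auto intro: f)
  have "(\<integral>v. (\<Prod>b\<in>Basis. f b (v \<bullet> b)) \<partial>(lborel :: 'b measure))
      = (\<integral>g. (\<Prod>b\<in>Basis. f b (g b)) \<partial>Pi\<^sub>M Basis (\<lambda>_. lborel))"
    by (subst lborel_eq, subst integral_distr[OF T F]) (unfold FT, rule refl)
  also have "\<dots> = (\<Prod>b\<in>Basis. integral\<^sup>L lborel (f b))"
    by (intro product_integral_prod) (auto intro: f)
  finally show ?eq .
qed

lemma prod_Basis_vec:
  "(\<Prod>b\<in>(Basis :: (real^'n) set). h b) = (\<Prod>i\<in>UNIV. h (axis i 1))"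
proof -
  have "(Basis :: (real^'n) set) = range (\<lambda>i. axis i 1)"
    by (auto simp: Basis_vec_def)
  moreover have "inj (\<lambda>i::'n. axis i (1::real))"
    by (auto simp: inj_on_def axis_eq_axis)
  ultimately show ?thesis by (intro prod.reindex_cong[of "\<lambda>i. axis i 1"]) auto
qed

lemma
  fixes f :: "'n::finite \<Rightarrow> real \<Rightarrow> real"
  assumes f: "\<And>i. integrable lborel (f i)"
  shows integrable_lborel_prod_vec:
      "integrable lborel (\<lambda>v::real^'n. \<Prod>i\<in>UNIV. f i (v $ i))"
    and integral_lborel_prod_vec:
      "(\<integral>v. (\<Prod>i\<in>UNIV. f i (v $ i)) \<partial>(lborel :: (real^'n) measure)) = (\<Prod>i\<in>UNIV. integral\<^sup>L lborel (f i))"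
proof -
  \<comment> \<open>The factors are re-indexed by basis vectors; the choice is unambiguous because
    distinct indices give distinct axis vectors.\<close>
  define h :: "real^'n \<Rightarrow> real \<Rightarrow> real" where "h b = f (SOME i. b = axis i 1)" for b
  have h: "h (axis i 1) = f i" for i
    unfolding h_def by (rule arg_cong[of _ _ f], rule some_equality) (auto simp: axis_eq_axis)
  have "integrable lborel (h b)" for b by (simp add: h_def f)
  hence "integrable lborel (\<lambda>v. \<Prod>b\<in>Basis. h b (v \<bullet> b))"
    and "(\<integral>v. (\<Prod>b\<in>Basis. h b (v \<bullet> b)) \<partial>lborel) = (\<Prod>b\<in>Basis. integral\<^sup>L lborel (h b))"
    by (rule integrable_lborel_prod_Basis integral_lborel_prod_Basis)+
  thus "integrable lborel (\<lambda>v::real^'n. \<Prod>i\<in>UNIV. f i (v $ i))"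
    and "(\<integral>v. (\<Prod>i\<in>UNIV. f i (v $ i)) \<partial>(lborel :: (real^'n) measure)) = (\<Prod>i\<in>UNIV. integral\<^sup>L lborel (f i))"
    by (simp_all add: prod_Basis_vec h inner_axis)
qed

text \<open>With covariance \<open>\<sigma>\<^sup>2 *\<^sub>R mat 1\<close> the quadratic form is a
  sum over coordinates and the determinant a power, so the joint density factors into
  one-dimensional normal densities.\<close>

lemma mvn_density_scaled_identity:
  fixes v :: "real^'n"
  assumes "0 < \<sigma>"
  shows "mvn_density 0 (\<sigma>\<^sup>2 *\<^sub>R mat 1) v = (\<Prod>i\<in>UNIV. normal_density 0 \<sigma> (v $ i))"
proof -
  let ?S = "\<sigma>\<^sup>2 *\<^sub>R mat 1 :: real^'n^'n"
  let ?T = "inverse (\<sigma>\<^sup>2) *\<^sub>R mat 1 :: real^'n^'n"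
  have mm: "(a *\<^sub>R mat 1) ** (b *\<^sub>R mat 1) = ((a * b) *\<^sub>R mat 1 :: real^'n^'n)" for a b
    by (simp add: matrix_scalar_ac scalar_matrix_assoc[symmetric])
  have ST: "?S ** ?T = mat 1" "?T ** ?S = mat 1" using assms by (simp_all add: mm)
  \<comment> \<open>\<open>matrix_inv\<close> is defined by choice, so it is first shown to be a
    two-sided inverse and then identified with \<open>?T\<close> by uniqueness.\<close>
  have "?S ** matrix_inv ?S = mat 1 \<and> matrix_inv ?S ** ?S = mat 1"
    unfolding matrix_inv_def by (rule someI[of "\<lambda>B. ?S ** B = mat 1 \<and> B ** ?S = mat 1" ?T]) (use ST in blast)
  hence inv: "matrix_inv ?S = ?T"
    by (metis ST(1) matrix_mul_assoc matrix_mul_lid matrix_mul_rid)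
  have det: "det ?S = (\<sigma>\<^sup>2) ^ CARD('n)"
    by (subst det_diagonal) (auto simp: mat_def)
  have "?T *v v = inverse (\<sigma>\<^sup>2) *\<^sub>R v"
    by (metis matrix_vector_mul_lid scaleR_matrix_vector_assoc)
  moreover have "(\<Sum>i\<in>UNIV. (v $ i)\<^sup>2 / (2 * \<sigma>\<^sup>2)) = (v \<bullet> v) / (2 * \<sigma>\<^sup>2)"
    by (simp add: inner_vec_def power2_eq_square sum_divide_distrib)
  ultimately have quad: "(v \<bullet> (?T *v v)) / 2 = (\<Sum>i\<in>UNIV. (v $ i)\<^sup>2 / (2 * \<sigma>\<^sup>2))"
    by (simp add: field_simps)
  have sqrt: "sqrt ((2 * pi) ^ CARD('n) * det ?S) = sqrt (2 * pi * \<sigma>\<^sup>2) ^ CARD('n)"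
    unfolding det by (simp only: real_sqrt_power[symmetric] power_mult_distrib[symmetric])
  have "exp (- (\<Sum>i\<in>UNIV. (v $ i)\<^sup>2 / (2 * \<sigma>\<^sup>2))) / sqrt (2 * pi * \<sigma>\<^sup>2) ^ CARD('n)
      = (\<Prod>i\<in>UNIV. normal_density 0 \<sigma> (v $ i))"
    by (simp add: normal_density_def prod_dividef exp_sum sum_negf[symmetric])
  thus ?thesis
    unfolding mvn_density_def inv sqrt diff_zero minus_divide_left[symmetric] quad .
qed

context prob_space
begin

text \<open>The density is a product, so the expectation of a monomial is the product of
  one-dimensional moments. Varying the exponents \<open>k\<close> yields every moment used for the
  noise.\<close>

lemma
  fixes X :: "'a \<Rightarrow> real^'n" and k :: "'n \<Rightarrow> nat"
  assumes X: "multivariate_normal X 0 (\<sigma>\<^sup>2 *\<^sub>R mat 1)" and \<sigma>: "0 < \<sigma>"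
  shows isotropic_normal_integrable_monomial:
      "integrable M (\<lambda>\<omega>. \<Prod>i\<in>UNIV. X \<omega> $ i ^ k i)" (is ?int)
    and isotropic_normal_moment:
      "(\<integral>\<omega>. (\<Prod>i\<in>UNIV. X \<omega> $ i ^ k i) \<partial>M)
        = (\<Prod>i\<in>UNIV. \<integral>t. normal_density 0 \<sigma> t * t ^ k i \<partial>lborel)" (is ?eq)
proof -
  let ?d = "\<lambda>v::real^'n. \<Prod>i\<in>UNIV. normal_density 0 \<sigma> (v $ i)"
  have D: "distributed M lborel X (\<lambda>v. ennreal (?d v))"
    using X by (simp add: multivariate_normal_def mvn_density_scaled_identity[OF \<sigma>])
  have d0: "0 \<le> ?d v" for v by (simp add: prod_nonneg)
  have m: "(\<lambda>v::real^'n. \<Prod>i\<in>UNIV. v $ i ^ k i) \<in> borel_measurable lborel" by measurable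
  have int: "integrable lborel (\<lambda>t. normal_density 0 \<sigma> t * t ^ k i)" for i
    using integrable_normal_moment[OF \<sigma>, of 0 "k i"] by simp
  have eq: "?d v * (\<Prod>i\<in>UNIV. v $ i ^ k i) = (\<Prod>i\<in>UNIV. normal_density 0 \<sigma> (v $ i) * v $ i ^ k i)"
    for v by (simp add: prod.distrib)
  note prods = integrable_lborel_prod_vec[of "\<lambda>i t. normal_density 0 \<sigma> t * t ^ k i", OF int]
    integral_lborel_prod_vec[of "\<lambda>i t. normal_density 0 \<sigma> t * t ^ k i", OF int]
  show ?int
    using distributed_integrable[OF D m] prods(1) by (simp add: d0 eq)
  show ?eq
    using distributed_integral[OF D m] prods(2) by (simp add: d0 eq)
qed

end

lemma prod_power_indicator:
  fixes v :: "real^'n"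
  shows "(\<Prod>l\<in>UNIV. v $ l ^ (if l = i then a else 0)) = v $ i ^ a"
proof -
  have "v $ l ^ (if l = i then a else 0) = (if l = i then v $ i ^ a else 1)" for l by simp
  thus ?thesis by simp
qed

lemma normal_moments:
  assumes "0 < \<sigma>"
  shows "(\<integral>t. normal_density 0 \<sigma> t * t \<partial>lborel) = 0"
    and "(\<integral>t. normal_density 0 \<sigma> t * t\<^sup>2 \<partial>lborel) = \<sigma>\<^sup>2"
  using integral_normal_moment_odd[OF assms, of 0 0] integral_normal_moment_even[OF assms, of 0 1] assms
  by (simp_all add: fact_numeral)

context prob_space
begin

lemma isotropic_normal_low_moments:
  fixes X :: "'a \<Rightarrow> real^'n"
  assumes X: "multivariate_normal X 0 (\<sigma>\<^sup>2 *\<^sub>R mat 1)" and \<sigma>: "0 < \<sigma>"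
  shows "integrable M (\<lambda>\<omega>. X \<omega> $ i ^ 4)"
    and "(\<integral>\<omega>. X \<omega> $ i ^ 4 \<partial>M) = (\<integral>t. normal_density 0 \<sigma> t * t ^ 4 \<partial>lborel)"
    and "(\<integral>\<omega>. X \<omega> $ i \<partial>M) = 0"
    and "(\<integral>\<omega>. X \<omega> $ i * X \<omega> $ j \<partial>M) = (if i = j then \<sigma>\<^sup>2 else 0)"
proof -
  note int = isotropic_normal_integrable_monomial[OF X \<sigma>]
  note mom = isotropic_normal_moment[OF X \<sigma>]
  show "integrable M (\<lambda>\<omega>. X \<omega> $ i ^ 4)"
    using int[of "\<lambda>l. if l = i then 4 else 0"] by (simp add: prod_power_indicator)
  show "(\<integral>\<omega>. X \<omega> $ i ^ 4 \<partial>M) = (\<integral>t. normal_density 0 \<sigma> t * t ^ 4 \<partial>lborel)"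
  proof -
    have "(\<integral>\<omega>. X \<omega> $ i ^ 4 \<partial>M)
      = (\<Prod>l\<in>UNIV. \<integral>t. normal_density 0 \<sigma> t * t ^ (if l = i then 4 else 0) \<partial>lborel)"
      using mom[of "\<lambda>l. if l = i then 4 else 0"] by (simp only: prod_power_indicator)
    also have "\<dots> = (\<Prod>l\<in>UNIV. if l = i then \<integral>t. normal_density 0 \<sigma> t * t ^ 4 \<partial>lborel else 1)"
      using \<sigma> by (intro prod.cong) auto
    finally show ?thesis by simp
  qed
  show "(\<integral>\<omega>. X \<omega> $ i \<partial>M) = 0"
  proof -
    have "(\<integral>\<omega>. X \<omega> $ i \<partial>M)
      = (\<Prod>l\<in>UNIV. \<integral>t. normal_density 0 \<sigma> t * t ^ (if l = i then 1 else 0) \<partial>lborel)"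
      using mom[of "\<lambda>l. if l = i then 1 else 0"] by (simp only: prod_power_indicator power_one_right)
    also have "\<dots> = 0" using normal_moments[OF \<sigma>] by (intro prod_zero) auto
    finally show ?thesis .
  qed
  show "(\<integral>\<omega>. X \<omega> $ i * X \<omega> $ j \<partial>M) = (if i = j then \<sigma>\<^sup>2 else 0)"
  proof -
    \<comment> \<open>Adding two indicators treats both cases at once: the exponent is 2 at
      \<open>i\<close> when \<open>i = j\<close>, and 1 at each of two different coordinates
      otherwise.\<close>
    define k where "k l = (if l = i then 1 else 0) + (if l = j then 1 else (0::nat))" for l
    have "(\<integral>\<omega>. X \<omega> $ i * X \<omega> $ j \<partial>M)
        = (\<Prod>l\<in>UNIV. \<integral>t. normal_density 0 \<sigma> t * t ^ k l \<partial>lborel)"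
      using mom[of k] by (simp only: k_def power_add prod.distrib prod_power_indicator power_one_right)
    also have "\<dots> = (if i = j then \<sigma>\<^sup>2 else 0)"
    proof (cases "i = j")
      case True
      have "(\<integral>t. normal_density 0 \<sigma> t * t ^ k l \<partial>lborel) = (if l = i then \<sigma>\<^sup>2 else 1)" for l
        using True normal_moments[OF \<sigma>] \<sigma> by (simp add: k_def power2_eq_square)
      thus ?thesis using True by simp
    next
      case False
      have "(\<integral>t. normal_density 0 \<sigma> t * t ^ k i \<partial>lborel) = 0"
        using False normal_moments[OF \<sigma>] by (simp add: k_def)
      thus ?thesis using False by (auto intro: prod_zero)
    qed
    finally show ?thesis .
  qed
qed

end

section \<open>Convergence to zero in probability\<close>

lemma integrable_mult_of_square_integrable:
  fixes f g :: "'a \<Rightarrow> real"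
  assumes [measurable]: "f \<in> borel_measurable M" "g \<in> borel_measurable M"
    and "integrable M (\<lambda>\<omega>. (f \<omega>)\<^sup>2)" "integrable M (\<lambda>\<omega>. (g \<omega>)\<^sup>2)"
  shows "integrable M (\<lambda>\<omega>. f \<omega> * g \<omega>)"
proof (rule Bochner_Integration.integrable_bound)
  show "integrable M (\<lambda>\<omega>. (f \<omega>)\<^sup>2 + (g \<omega>)\<^sup>2)" using assms by simp
  have "\<bar>a * b\<bar> \<le> a\<^sup>2 + b\<^sup>2" for a b :: real
    using sum_squares_bound[of "\<bar>a\<bar>" "\<bar>b\<bar>"] mult_nonneg_nonneg[of "\<bar>a\<bar>" "\<bar>b\<bar>"]
    unfolding abs_mult power2_abs by linarith
  thus "AE \<omega> in M. norm (f \<omega> * g \<omega>) \<le> norm ((f \<omega>)\<^sup>2 + (g \<omega>)\<^sup>2)" by simp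
qed simp

context prob_space
begin

text \<open>Convergence to zero in probability, in a form that does not ask for measurability of \<open>Z\<close>.\<close>

definition vanishes_in_prob :: "(nat \<Rightarrow> 'a \<Rightarrow> 'b::real_normed_vector) \<Rightarrow> bool" where
  "vanishes_in_prob Z \<longleftrightarrow> (\<forall>\<epsilon>>0. \<forall>\<^sub>F n in sequentially.
     \<exists>E\<in>events. prob E < \<epsilon> \<and> (\<forall>\<omega>\<in>space M - E. norm (Z n \<omega>) \<le> \<epsilon>))"

section \<open>Closure properties of convergence to zero in probability\<close>

lemma vanishes_in_prob_bound:
  assumes Z: "vanishes_in_prob Z"
    and le: "\<And>n \<omega>. 0 < n \<Longrightarrow> \<omega> \<in> space M \<Longrightarrow> norm (Y n \<omega>) \<le> C * norm (Z n \<omega>)"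
  shows "vanishes_in_prob Y"
  unfolding vanishes_in_prob_def
proof (intro allI impI)
  fix \<epsilon> :: real assume "0 < \<epsilon>"
  \<comment> \<open>The factor \<open>\<bar>C\<bar> + 1\<close> is positive for every
    \<open>C\<close> and at least 1, so that \<open>\<delta> \<le> \<epsilon>\<close> and the same
    exceptional event serves for \<open>Y\<close>.\<close>
  define \<delta> where "\<delta> = \<epsilon> / (\<bar>C\<bar> + 1)"
  have \<delta>: "0 < \<delta>" "(\<bar>C\<bar> + 1) * \<delta> = \<epsilon>"
    using \<open>0 < \<epsilon>\<close> by (simp_all add: \<delta>_def)
  with mult_right_mono[of 1 "\<bar>C\<bar> + 1" \<delta>] have "\<delta> \<le> \<epsilon>" by simp
  have Y_le: "norm (Y n \<omega>) \<le> \<epsilon>" if "0 < n" "\<omega> \<in> space M" "norm (Z n \<omega>) \<le> \<delta>" for n \<omega>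
  proof -
    have "norm (Y n \<omega>) \<le> (\<bar>C\<bar> + 1) * norm (Z n \<omega>)"
      using mult_right_mono[of C "\<bar>C\<bar> + 1" "norm (Z n \<omega>)"]
      by (intro order_trans[OF le[OF that(1,2)]]) auto
    also have "\<dots> \<le> (\<bar>C\<bar> + 1) * \<delta>" by (intro mult_left_mono that) simp
    finally show ?thesis using \<delta>(2) by simp
  qed
  have "\<forall>\<^sub>F n in sequentially. \<exists>E\<in>events. prob E < \<delta> \<and> (\<forall>\<omega>\<in>space M - E. norm (Z n \<omega>) \<le> \<delta>)"
    using Z \<delta>(1) by (simp add: vanishes_in_prob_def)
  moreover have "\<forall>\<^sub>F n in sequentially. 0 < (n::nat)" by (rule eventually_gt_at_top)
  ultimately show "\<forall>\<^sub>F n in sequentially. \<exists>E\<in>events. prob E < \<epsilon> \<and> (\<forall>\<omega>\<in>space M - E. norm (Y n \<omega>) \<le> \<epsilon>)"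
  proof eventually_elim
    case (elim n)
    thus ?case by (meson Y_le DiffD1 \<open>\<delta> \<le> \<epsilon>\<close> order_less_le_trans)
  qed
qed

lemma vanishes_in_prob_add:
  assumes "vanishes_in_prob Y" "vanishes_in_prob Z"
  shows "vanishes_in_prob (\<lambda>n \<omega>. Y n \<omega> + Z n \<omega>)"
  unfolding vanishes_in_prob_def
proof (intro allI impI)
  fix \<epsilon> :: real assume "0 < \<epsilon>"
  hence "\<forall>\<^sub>F n in sequentially. \<exists>E\<in>events. prob E < \<epsilon>/2 \<and> (\<forall>\<omega>\<in>space M - E. norm (Y n \<omega>) \<le> \<epsilon>/2)"
    and "\<forall>\<^sub>F n in sequentially. \<exists>E\<in>events. prob E < \<epsilon>/2 \<and> (\<forall>\<omega>\<in>space M - E. norm (Z n \<omega>) \<le> \<epsilon>/2)"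
    using assms half_gt_zero unfolding vanishes_in_prob_def by blast+
  thus "\<forall>\<^sub>F n in sequentially. \<exists>E\<in>events. prob E < \<epsilon> \<and> (\<forall>\<omega>\<in>space M - E. norm (Y n \<omega> + Z n \<omega>) \<le> \<epsilon>)"
  proof eventually_elim
    case (elim n)
    then obtain E F where *: "E \<in> events" "prob E < \<epsilon>/2" "\<forall>\<omega>\<in>space M - E. norm (Y n \<omega>) \<le> \<epsilon>/2"
      "F \<in> events" "prob F < \<epsilon>/2" "\<forall>\<omega>\<in>space M - F. norm (Z n \<omega>) \<le> \<epsilon>/2" by blast
    have "prob (E \<union> F) < \<epsilon>" using measure_Un_le[of E M F] * by simp
    moreover have "norm (Y n \<omega> + Z n \<omega>) \<le> \<epsilon>" if "\<omega> \<in> space M - (E \<union> F)" for \<omega>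
      using norm_triangle_ineq[of "Y n \<omega>" "Z n \<omega>"] *(3)[rule_format, of \<omega>] *(6)[rule_format, of \<omega>] that
      by simp
    ultimately show ?case using *(1,4) by (intro bexI[of _ "E \<union> F"]) auto
  qed
qed

text \<open>Only positive \<open>n\<close> are compared because identities between averages may fail
  at \<open>n = 0\<close>, where the average is zero by convention.\<close>

lemma vanishes_in_prob_cong:
  assumes "vanishes_in_prob Z" "\<And>n \<omega>. 0 < n \<Longrightarrow> \<omega> \<in> space M \<Longrightarrow> Y n \<omega> = Z n \<omega>"
  shows "vanishes_in_prob Y"
  by (rule vanishes_in_prob_bound[OF assms(1), of _ 1]) (simp add: assms(2))

lemma vanishes_in_prob_linear:
  fixes f :: "'b::euclidean_space \<Rightarrow> 'c::real_normed_vector"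
  assumes "linear f" "vanishes_in_prob Z"
  shows "vanishes_in_prob (\<lambda>n \<omega>. f (Z n \<omega>))"
proof -
  have "bounded_linear f" using assms(1) by (simp add: linear_conv_bounded_linear)
  then obtain K where "\<And>z. norm (f z) \<le> norm z * K" using bounded_linear.bounded by blast
  thus ?thesis
    by (intro vanishes_in_prob_bound[OF assms(2), of _ K]) (simp add: mult.commute)
qed

lemma vanishes_in_prob_diff:
  assumes "vanishes_in_prob Y" "vanishes_in_prob Z"
  shows "vanishes_in_prob (\<lambda>n \<omega>. Y n \<omega> - Z n \<omega>)"
proof -
  have "vanishes_in_prob (\<lambda>n \<omega>. - Z n \<omega>)"
    by (rule vanishes_in_prob_bound[OF assms(2), of _ 1]) simp
  from vanishes_in_prob_add[OF assms(1) this] show ?thesis by simp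
qed

lemma vanishes_in_prob_sum:
  assumes "finite I" "\<And>i. i \<in> I \<Longrightarrow> vanishes_in_prob (Z i)"
  shows "vanishes_in_prob (\<lambda>n \<omega>. \<Sum>i\<in>I. Z i n \<omega>)"
  using assms
proof (induction I rule: finite_induct)
  case empty
  show ?case unfolding vanishes_in_prob_def by (auto intro!: bexI[of _ "{}"])
next
  case (insert i I)
  thus ?case by (simp add: vanishes_in_prob_add)
qed

lemma vanishes_in_prob_vec:
  fixes Z :: "nat \<Rightarrow> 'a \<Rightarrow> 'b::real_normed_vector^'n"
  assumes "\<And>i. vanishes_in_prob (\<lambda>n \<omega>. Z n \<omega> $ i)"
  shows "vanishes_in_prob Z"
proof -
  have "vanishes_in_prob (\<lambda>n \<omega>. norm (Z n \<omega> $ i))" for i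
    by (rule vanishes_in_prob_bound[OF assms[of i], of _ 1]) simp
  hence "vanishes_in_prob (\<lambda>n \<omega>. \<Sum>i\<in>UNIV. norm (Z n \<omega> $ i))"
    by (intro vanishes_in_prob_sum) auto
  thus ?thesis
    by (rule vanishes_in_prob_bound[of _ _ 1])
      (simp add: norm_vec_def L2_set_le_sum order_trans[OF _ abs_ge_self])
qed

lemma vanishes_in_prob_L1:
  fixes V :: "nat \<Rightarrow> 'a \<Rightarrow> real"
  assumes int: "\<And>n. integrable M (V n)" and nn: "\<And>n \<omega>. 0 \<le> V n \<omega>"
    and lim: "(\<lambda>n. expectation (V n)) \<longlonglongrightarrow> 0"
  shows "vanishes_in_prob V"
  unfolding vanishes_in_prob_def
proof (intro allI impI)
  fix \<epsilon> :: real assume \<epsilon>: "0 < \<epsilon>"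
  \<comment> \<open>Markov's inequality at level \<open>\<epsilon>\<close> divides by
    \<open>\<epsilon>\<close>, hence the threshold \<open>\<epsilon> * \<epsilon>\<close> for the
    expectation.\<close>
  have "\<forall>\<^sub>F n in sequentially. expectation (V n) < \<epsilon> * \<epsilon>"
    using \<epsilon> by (intro order_tendstoD[OF lim]) simp
  thus "\<forall>\<^sub>F n in sequentially. \<exists>E\<in>events. prob E < \<epsilon> \<and> (\<forall>\<omega>\<in>space M - E. norm (V n \<omega>) \<le> \<epsilon>)"
  proof eventually_elim
    case (elim n)
    let ?E = "{\<omega>\<in>space M. V n \<omega> \<ge> \<epsilon>}"
    have [measurable]: "V n \<in> borel_measurable M" using int by auto
    have "prob ?E \<le> expectation (V n) / \<epsilon>"
      using integral_Markov_inequality_measure[OF int[of n] sets.top _ \<epsilon>] nn by auto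
    also have "\<dots> < \<epsilon>" using elim \<epsilon> by (simp add: field_simps)
    finally show ?case using nn[of n] by (intro bexI[of _ ?E]) auto
  qed
qed

lemma vanishes_in_prob_L2:
  fixes V :: "nat \<Rightarrow> 'a \<Rightarrow> real"
  assumes int: "\<And>n. integrable M (\<lambda>\<omega>. (V n \<omega>)\<^sup>2)"
    and lim: "(\<lambda>n. expectation (\<lambda>\<omega>. (V n \<omega>)\<^sup>2)) \<longlonglongrightarrow> 0"
  shows "vanishes_in_prob V"
  unfolding vanishes_in_prob_def
proof (intro allI impI)
  fix \<epsilon> :: real assume \<epsilon>: "0 < \<epsilon>"
  \<comment> \<open>The minimum serves two ends: the exceptional probability stays below
    \<open>\<epsilon>\<close>, and a square bounded by \<open>\<epsilon>\<^sup>2\<close> has root at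
    most \<open>\<epsilon>\<close>.\<close>
  define \<delta> where "\<delta> = min \<epsilon> (\<epsilon>\<^sup>2)"
  have "0 < \<delta>" using \<epsilon> by (simp add: \<delta>_def)
  with vanishes_in_prob_L1[OF int _ lim]
  have "\<forall>\<^sub>F n in sequentially. \<exists>E\<in>events. prob E < \<delta> \<and> (\<forall>\<omega>\<in>space M - E. norm ((V n \<omega>)\<^sup>2) \<le> \<delta>)"
    by (simp add: vanishes_in_prob_def)
  moreover have "norm v \<le> \<epsilon>" if "norm (v\<^sup>2) \<le> \<delta>" for v :: real
    using that \<epsilon> by (intro power2_le_imp_le[of "norm v" \<epsilon>]) (auto simp: \<delta>_def)
  ultimately show "\<forall>\<^sub>F n in sequentially. \<exists>E\<in>events. prob E < \<epsilon> \<and> (\<forall>\<omega>\<in>space M - E. norm (V n \<omega>) \<le> \<epsilon>)"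
    by (elim eventually_mono) (fastforce simp: \<delta>_def)
qed

text \<open>The events decrease to the empty set as the level grows, because \<open>U\<close> takes
  finite values; continuity from above finishes.\<close>

lemma tight_random_variable:
  fixes U :: "'a \<Rightarrow> real"
  assumes [measurable]: "U \<in> borel_measurable M" and "0 < \<epsilon>"
  shows "\<exists>K>0. prob {\<omega>\<in>space M. K < \<bar>U \<omega>\<bar>} < \<epsilon>"
proof -
  let ?E = "\<lambda>n::nat. {\<omega>\<in>space M. real n < \<bar>U \<omega>\<bar>}"
  have "(\<Inter>n. ?E n) = {}"
    using reals_Archimedean2 by (auto, metis less_asym)
  moreover have "(\<lambda>n. prob (?E n)) \<longlonglongrightarrow> prob (\<Inter>n. ?E n)"
    by (rule finite_Lim_measure_decseq) (auto simp: decseq_def)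
  ultimately have "(\<lambda>n. prob (?E n)) \<longlonglongrightarrow> 0" by simp
  hence "\<forall>\<^sub>F n in sequentially. prob (?E n) < \<epsilon>" using \<open>0 < \<epsilon>\<close> by (rule order_tendstoD)
  moreover have "\<forall>\<^sub>F n in sequentially. 0 < n" by (rule eventually_gt_at_top)
  ultimately have "\<forall>\<^sub>F n in sequentially. prob (?E n) < \<epsilon> \<and> 0 < n" by (rule eventually_conj)
  then obtain n where "prob (?E n) < \<epsilon>" "0 < n"
    using eventually_happens[of _ sequentially] by auto
  thus ?thesis by (intro exI[of _ "real n"]) auto
qed

text \<open>Off an event of small probability \<open>U\<close> is bounded by a constant. Since
  \<open>U\<close> may lack moments, the initial state can enter through such a factor.\<close>

lemma vanishes_in_prob_mult:
  fixes U :: "'a \<Rightarrow> real" and V :: "nat \<Rightarrow> 'a \<Rightarrow> real"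
  assumes [measurable]: "U \<in> borel_measurable M" and V: "vanishes_in_prob V"
  shows "vanishes_in_prob (\<lambda>n \<omega>. U \<omega> * V n \<omega>)"
  unfolding vanishes_in_prob_def
proof (intro allI impI)
  fix \<epsilon> :: real assume \<epsilon>: "0 < \<epsilon>"
  then obtain K where K: "K > 0" "prob {\<omega>\<in>space M. K < \<bar>U \<omega>\<bar>} < \<epsilon>/2"
    using tight_random_variable[OF assms(1), of "\<epsilon>/2"] by auto
  define \<delta> where "\<delta> = min (\<epsilon>/2) (\<epsilon>/K)"
  have "0 < \<delta>" using \<epsilon> K by (simp add: \<delta>_def)
  with V have "\<forall>\<^sub>F n in sequentially. \<exists>E\<in>events. prob E < \<delta> \<and> (\<forall>\<omega>\<in>space M - E. norm (V n \<omega>) \<le> \<delta>)"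
    by (simp add: vanishes_in_prob_def)
  thus "\<forall>\<^sub>F n in sequentially. \<exists>E\<in>events. prob E < \<epsilon> \<and> (\<forall>\<omega>\<in>space M - E. norm (U \<omega> * V n \<omega>) \<le> \<epsilon>)"
  proof eventually_elim
    case (elim n)
    then obtain E where E: "E \<in> events" "prob E < \<delta>" "\<And>\<omega>. \<omega>\<in>space M - E \<Longrightarrow> norm (V n \<omega>) \<le> \<delta>" by blast
    let ?F = "{\<omega>\<in>space M. K < \<bar>U \<omega>\<bar>}"
    have F: "?F \<in> events" by measurable
    have "prob (E \<union> ?F) < \<epsilon>"
      using measure_Un_le[OF E(1) F] E(2) K(2) by (simp add: \<delta>_def)
    moreover have "norm (U \<omega> * V n \<omega>) \<le> \<epsilon>" if "\<omega> \<in> space M - (E \<union> ?F)" for \<omega>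
    proof -
      have "\<bar>U \<omega>\<bar> * \<bar>V n \<omega>\<bar> \<le> K * \<delta>"
        using that E(3)[of \<omega>] K(1) by (intro mult_mono) auto
      also have "\<dots> \<le> \<epsilon>" using K(1) by (simp add: \<delta>_def min_def field_simps)
      finally show ?thesis by (simp add: abs_mult)
    qed
    ultimately show ?case using E(1) F by (intro bexI[of _ "E \<union> ?F"]) auto
  qed
qed

text \<open>The complement of the exceptional event lies in \<open>G n\<close>; this converts
  vanishing errors into the limits of probabilities in the theorem.\<close>

lemma prob_tendsto_1_if_vanishes_in_prob:
  assumes Z: "vanishes_in_prob Z" and "0 < \<delta>" and G: "\<And>n. G n \<in> events"
    and sub: "\<And>n \<omega>. \<omega> \<in> space M \<Longrightarrow> norm (Z n \<omega>) \<le> \<delta> \<Longrightarrow> \<omega> \<in> G n"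
  shows "(\<lambda>n. prob (G n)) \<longlonglongrightarrow> 1"
proof (rule order_tendstoI)
  fix a :: real assume "1 < a"
  thus "\<forall>\<^sub>F n in sequentially. prob (G n) < a"
    using prob_le_1 by (intro always_eventually allI) (meson le_less_trans)
next
  fix a :: real assume a: "a < 1"
  define \<epsilon> where "\<epsilon> = min (1 - a) \<delta>"
  have \<epsilon>: "0 < \<epsilon>" "\<epsilon> \<le> 1 - a" "\<epsilon> \<le> \<delta>" using a \<open>0 < \<delta>\<close> by (auto simp: \<epsilon>_def)
  have "\<forall>\<^sub>F n in sequentially. \<exists>E\<in>events. prob E < \<epsilon> \<and> (\<forall>\<omega>\<in>space M - E. norm (Z n \<omega>) \<le> \<epsilon>)"
    using Z \<epsilon>(1) by (simp add: vanishes_in_prob_def)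
  thus "\<forall>\<^sub>F n in sequentially. a < prob (G n)"
  proof eventually_elim
    case (elim n)
    then obtain E where E: "E \<in> events" "prob E < \<epsilon>" "\<And>\<omega>. \<omega>\<in>space M - E \<Longrightarrow> norm (Z n \<omega>) \<le> \<epsilon>" by auto
    have "a < 1 - prob E" using E(2) \<epsilon>(2) by simp
    also have "\<dots> = prob (space M - E)" using prob_compl[OF E(1)] by simp
    also have "\<dots> \<le> prob (G n)"
      using E(3) \<epsilon>(3) by (intro finite_measure_mono G) (force intro: sub)
    finally show ?case .
  qed
qed

text \<open>A weak law of large numbers: by orthogonality the second moment of the sum is at most
  \<open>n * C\<close>, so that of the average is at most \<open>C / n\<close>.\<close>

lemma vanishes_in_prob_orthogonal_average:
  fixes u :: "nat \<Rightarrow> 'a \<Rightarrow> real"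
  assumes [measurable]: "\<And>l. u l \<in> borel_measurable M"
    and sq: "\<And>l. integrable M (\<lambda>\<omega>. (u l \<omega>)\<^sup>2)"
    and C: "\<And>l. expectation (\<lambda>\<omega>. (u l \<omega>)\<^sup>2) \<le> C"
    and orth: "\<And>l m. l < m \<Longrightarrow> expectation (\<lambda>\<omega>. u l \<omega> * u m \<omega>) = 0"
  shows "vanishes_in_prob (\<lambda>n \<omega>. (1 / real n) *\<^sub>R (\<Sum>l<n. u l \<omega>))"
proof (rule vanishes_in_prob_L2)
  have int2: "integrable M (\<lambda>\<omega>. u l \<omega> * u m \<omega>)" for l m
    by (rule integrable_mult_of_square_integrable) (auto intro: sq)
  have S: "integrable M (\<lambda>\<omega>. (\<Sum>l<n. u l \<omega>)\<^sup>2) \<and> expectation (\<lambda>\<omega>. (\<Sum>l<n. u l \<omega>)\<^sup>2) \<le> n * C" for n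
  proof (induction n)
    case (Suc n)
    have eq: "(\<Sum>l<Suc n. u l \<omega>)\<^sup>2
        = (\<Sum>l<n. u l \<omega>)\<^sup>2 + 2 * (\<Sum>l<n. u l \<omega> * u n \<omega>) + (u n \<omega>)\<^sup>2" for \<omega>
      by (simp add: power2_sum sum_distrib_right)
    have "expectation (\<lambda>\<omega>. \<Sum>l<n. u l \<omega> * u n \<omega>) = 0"
      by (subst Bochner_Integration.integral_sum) (auto simp: int2 orth)
    thus ?case
      using Suc sq[of n] C[of n] unfolding eq by (simp add: int2 algebra_simps)
  qed simp
  show "integrable M (\<lambda>\<omega>. ((1 / real n) *\<^sub>R (\<Sum>l<n. u l \<omega>))\<^sup>2)" for n
    using S[of n] by (simp add: power_divide)
  show "(\<lambda>n. expectation (\<lambda>\<omega>. ((1 / real n) *\<^sub>R (\<Sum>l<n. u l \<omega>))\<^sup>2)) \<longlonglongrightarrow> 0"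
  proof (rule tendsto_sandwich[OF _ _ tendsto_const lim_const_over_n[of C]])
    have "expectation (\<lambda>\<omega>. ((1 / real n) *\<^sub>R (\<Sum>l<n. u l \<omega>))\<^sup>2) \<le> C / n" for n
      using S[of n] by (cases "n = 0") (simp_all add: power_divide power2_eq_square field_simps)
    thus "\<forall>\<^sub>F n in sequentially. expectation (\<lambda>\<omega>. ((1 / real n) *\<^sub>R (\<Sum>l<n. u l \<omega>))\<^sup>2) \<le> C / n" by simp
  qed simp
qed

end

section \<open>Autoregression driven by white noise\<close>

definition running_mean :: "(nat \<Rightarrow> 'b::real_vector) \<Rightarrow> nat \<Rightarrow> 'b" where
  "running_mean f n = (1 / real n) *\<^sub>R (\<Sum>l<n. f l)"

lemma running_mean_add: "running_mean (\<lambda>l. f l + g l) n = running_mean f n + running_mean g n"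
  by (simp add: running_mean_def sum.distrib scaleR_add_right)

lemma running_mean_diff: "running_mean (\<lambda>l. f l - g l) n = running_mean f n - running_mean g n"
  by (simp add: running_mean_def sum_subtractf scaleR_diff_right)

lemma running_mean_const: "0 < n \<Longrightarrow> running_mean (\<lambda>_. c) n = c"
  by (simp add: running_mean_def sum_constant_scaleR)

lemma running_mean_linear: "linear h \<Longrightarrow> running_mean (\<lambda>l. h (f l)) n = h (running_mean f n)"
  by (simp add: running_mean_def linear_sum linear_scale)

lemma running_mean_telescope:
  "running_mean (\<lambda>l. f (Suc l) - f l) n = (1 / real n) *\<^sub>R (f n - f 0)"
  by (simp add: running_mean_def sum_lessThan_telescope)

lemma running_mean_nth: "running_mean f n $ i = running_mean (\<lambda>l. f l $ i) n"
  for f :: "nat \<Rightarrow> 'b::real_vector^'n"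
  by (simp add: running_mean_def)

text \<open>The state started at zero, written as a deterministic function of a noise trajectory. It
  reads only times 1 to \<open>n\<close>, and in this form the independence of future noise can be
  applied to it.\<close>

primrec linear_response :: "real^'n^'n \<Rightarrow> nat \<Rightarrow> (nat \<Rightarrow> real^'n) \<Rightarrow> real^'n" where
  "linear_response A 0 f = 0"
| "linear_response A (Suc n) f = A *v linear_response A n f + f (Suc n)"

lemma borel_measurable_matrix_vector_mult [measurable (raw)]:
  fixes A :: "real^'n^'m"
  assumes "f \<in> borel_measurable N"
  shows "(\<lambda>z. A *v f z) \<in> borel_measurable N"
proof -
  have "(*v) A \<in> borel_measurable borel"
    by (intro borel_measurable_continuous_onI matrix_vector_mult_linear_continuous_on)
  from measurable_compose[OF assms this] show ?thesis by simp
qed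

lemma borel_measurable_nth_compose [measurable (raw)]:
  fixes f :: "'a \<Rightarrow> real^'n"
  assumes "f \<in> borel_measurable N"
  shows "(\<lambda>z. f z $ i) \<in> borel_measurable N"
  using measurable_compose[OF assms, of "\<lambda>v. v $ i" borel] by simp

lemma measurable_linear_response:
  "n \<le> p \<Longrightarrow> linear_response A n \<in> borel_measurable (Pi\<^sub>M {1..p} (\<lambda>_. borel))"
proof (induction n)
  case 0
  have "linear_response A 0 = (\<lambda>_. 0)" by auto
  thus ?case by simp
next
  case (Suc n)
  have [measurable]: "(\<lambda>f. f (Suc n)) \<in> borel_measurable (Pi\<^sub>M {1..p} (\<lambda>_. borel))"
    using Suc.prems by (intro measurable_component_singleton) auto
  have [measurable]: "linear_response A n \<in> borel_measurable (Pi\<^sub>M {1..p} (\<lambda>_. borel))"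
    using Suc by simp
  show ?case unfolding linear_response.simps[abs_def] by measurable
qed

lemma linear_response_restrict:
  "n \<le> p \<Longrightarrow> linear_response A n (restrict f {1..p}) = linear_response A n f"
  by (induction n) auto

text \<open>The bound \<open>\<kappa>\<close> on the fourth moments makes the sample covariances of the noise square
  integrable uniformly in time.\<close>

locale white_noise = prob_space M for M :: "'a measure" +
  fixes x :: "nat \<Rightarrow> 'a \<Rightarrow> real^'n" and s \<kappa> :: real
  assumes indep: "indep_vars (\<lambda>_. borel) x {1..}"
    and integrable_fourth_moment: "1 \<le> n \<Longrightarrow> integrable M (\<lambda>\<omega>. x n \<omega> $ i ^ 4)"
    and fourth_moment_le: "1 \<le> n \<Longrightarrow> expectation (\<lambda>\<omega>. x n \<omega> $ i ^ 4) \<le> \<kappa>"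
    and mean: "1 \<le> n \<Longrightarrow> expectation (\<lambda>\<omega>. x n \<omega> $ i) = 0"
    and cov: "1 \<le> n \<Longrightarrow> expectation (\<lambda>\<omega>. x n \<omega> $ i * x n \<omega> $ j) = (if i = j then s else 0)"
begin

section \<open>Integrability of the noise and independence from its past\<close>

lemma measurable_noise [measurable]: "1 \<le> n \<Longrightarrow> x n \<in> borel_measurable M"
  using indep by (auto simp: indep_vars_def)

lemma measurable_noise_nth: "1 \<le> n \<Longrightarrow> (\<lambda>\<omega>. x n \<omega> $ i) \<in> borel_measurable M"
  by (intro borel_measurable_nth_compose measurable_noise)

lemma integrable_noise_sq: "1 \<le> n \<Longrightarrow> integrable M (\<lambda>\<omega>. (x n \<omega> $ i)\<^sup>2)"
proof -
  assume n: "1 \<le> n"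
  note [measurable] = measurable_noise[OF n]
  have "t\<^sup>2 \<le> 1 + t ^ 4" for t :: real
  proof -
    have "2 * t\<^sup>2 \<le> t ^ 4 + 1" using sum_squares_bound[of "t\<^sup>2" 1] by simp
    with zero_le_power2[of t] show ?thesis by linarith
  qed
  thus ?thesis
    by (intro Bochner_Integration.integrable_bound[of M "\<lambda>\<omega>. 1 + x n \<omega> $ i ^ 4" "\<lambda>\<omega>. (x n \<omega> $ i)\<^sup>2"])
      (auto simp: integrable_fourth_moment[OF n] intro: borel_measurable_power measurable_noise_nth[OF n])
qed

lemma integrable_noise: "1 \<le> n \<Longrightarrow> integrable M (\<lambda>\<omega>. x n \<omega> $ i)"
  by (rule square_integrable_imp_integrable[OF measurable_noise_nth integrable_noise_sq])

lemma integrable_noise_mult: "1 \<le> n \<Longrightarrow> integrable M (\<lambda>\<omega>. x n \<omega> $ i * x n \<omega> $ j)"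
  by (rule integrable_mult_of_square_integrable[OF measurable_noise_nth measurable_noise_nth
        integrable_noise_sq integrable_noise_sq])

text \<open>The index sets \<open>{q}\<close> and \<open>{1..p}\<close> are disjoint, so the
  corresponding subfamilies of the noise are independent. The hypothesis \<open>restrict\<close>
  says that \<open>G\<close> sees only times 1 to \<open>p\<close>, which lets it be evaluated on
  whole trajectories.\<close>

lemma
  fixes h :: "real^'n \<Rightarrow> real" and G :: "(nat \<Rightarrow> real^'n) \<Rightarrow> real"
  assumes G: "G \<in> borel_measurable (Pi\<^sub>M {1..p} (\<lambda>_. borel))"
    and restrict: "\<And>f. G (restrict f {1..p}) = G f"
    and h: "h \<in> borel_measurable borel" and "p < q"
    and int: "integrable M (\<lambda>\<omega>. h (x q \<omega>))" "integrable M (\<lambda>\<omega>. G (\<lambda>n. x n \<omega>))"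
  shows integrable_noise_past: "integrable M (\<lambda>\<omega>. h (x q \<omega>) * G (\<lambda>n. x n \<omega>))"
    and expectation_noise_past: "expectation (\<lambda>\<omega>. h (x q \<omega>) * G (\<lambda>n. x n \<omega>))
      = expectation (\<lambda>\<omega>. h (x q \<omega>)) * expectation (\<lambda>\<omega>. G (\<lambda>n. x n \<omega>))"
proof -
  have "indep_var (Pi\<^sub>M {q} (\<lambda>_. borel)) (\<lambda>\<omega>. restrict (\<lambda>i. x i \<omega>) {q})
      (Pi\<^sub>M {1..p} (\<lambda>_. borel)) (\<lambda>\<omega>. restrict (\<lambda>i. x i \<omega>) {1..p})"
    using \<open>p < q\<close> by (intro indep_var_restrict[OF indep]) auto
  from indep_var_compose[OF this, of "\<lambda>f. h (f q)" borel G borel]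
  have "indep_var borel ((\<lambda>f. h (f q)) \<circ> (\<lambda>\<omega>. restrict (\<lambda>i. x i \<omega>) {q}))
      borel (G \<circ> (\<lambda>\<omega>. restrict (\<lambda>i. x i \<omega>) {1..p}))"
    using G measurable_compose[OF measurable_component_singleton[of q "{q}" "\<lambda>_. borel"] h] by simp
  moreover have "(\<lambda>f. h (f q)) \<circ> (\<lambda>\<omega>. restrict (\<lambda>i. x i \<omega>) {q}) = (\<lambda>\<omega>. h (x q \<omega>))"
    by (simp add: o_def)
  moreover have "G \<circ> (\<lambda>\<omega>. restrict (\<lambda>i. x i \<omega>) {1..p}) = (\<lambda>\<omega>. G (\<lambda>n. x n \<omega>))"
    unfolding o_def by (rule ext) (rule restrict)
  ultimately have ind: "indep_var borel (\<lambda>\<omega>. h (x q \<omega>)) borel (\<lambda>\<omega>. G (\<lambda>n. x n \<omega>))" by metis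
  show "integrable M (\<lambda>\<omega>. h (x q \<omega>) * G (\<lambda>n. x n \<omega>))"
    by (rule indep_var_integrable[OF ind int])
  show "expectation (\<lambda>\<omega>. h (x q \<omega>) * G (\<lambda>n. x n \<omega>))
      = expectation (\<lambda>\<omega>. h (x q \<omega>)) * expectation (\<lambda>\<omega>. G (\<lambda>n. x n \<omega>))"
    by (rule indep_var_lebesgue_integral[OF ind int])
qed

text \<open>Each entry is an average of centred functions \<open>h\<close> of independent vectors.
  These are orthogonal, and the fourth moments bound their second moments uniformly.\<close>

lemma vanishes_in_prob_noise_covariance:
  "vanishes_in_prob (\<lambda>n \<omega>. running_mean (\<lambda>l. outer_product (x (Suc l) \<omega>) (x (Suc l) \<omega>) - s *\<^sub>R mat 1) n)"
proof (intro vanishes_in_prob_vec)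
  fix i j :: 'n
  define c where "c = (if i = j then s else 0)"
  define h :: "real^'n \<Rightarrow> real" where "h v = v $ i * v $ j - c" for v
  have [measurable]: "h \<in> borel_measurable borel" unfolding h_def by measurable
  have bound: "(h v)\<^sup>2 \<le> 2 * (v $ i ^ 4 + v $ j ^ 4) + 2 * c\<^sup>2" for v
  proof -
    have "(a * b - c)\<^sup>2 \<le> 2 * (a ^ 4 + b ^ 4) + 2 * c\<^sup>2" for a b :: real
    proof -
      \<comment> \<open>The right side minus the left side is exactly the sum of these four
        squares.\<close>
      have "0 \<le> (a * b + c)\<^sup>2" "0 \<le> (a\<^sup>2 - b\<^sup>2)\<^sup>2" "0 \<le> (a\<^sup>2)\<^sup>2" "0 \<le> (b\<^sup>2)\<^sup>2" by simp_all
      thus ?thesis by (simp add: power2_eq_square power4_eq_xxxx algebra_simps)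
    qed
    thus ?thesis by (simp add: h_def)
  qed
  have sq: "integrable M (\<lambda>\<omega>. (h (x (Suc l) \<omega>))\<^sup>2)" for l
  proof (rule Bochner_Integration.integrable_bound)
    show "integrable M (\<lambda>\<omega>. 2 * (x (Suc l) \<omega> $ i ^ 4 + x (Suc l) \<omega> $ j ^ 4) + 2 * c\<^sup>2)"
      by (simp add: integrable_fourth_moment)
    show "(\<lambda>\<omega>. (h (x (Suc l) \<omega>))\<^sup>2) \<in> borel_measurable M"
      using measurable_noise[of "Suc l"] by simp
    show "AE \<omega> in M. norm ((h (x (Suc l) \<omega>))\<^sup>2)
        \<le> norm (2 * (x (Suc l) \<omega> $ i ^ 4 + x (Suc l) \<omega> $ j ^ 4) + 2 * c\<^sup>2)"
      using bound order_trans[OF _ abs_ge_self] by (intro AE_I2) simp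
  qed
  have int: "integrable M (\<lambda>\<omega>. h (x (Suc l) \<omega>))" for l
    unfolding h_def by (simp add: integrable_noise_mult)
  have h0: "expectation (\<lambda>\<omega>. h (x (Suc l) \<omega>)) = 0" for l
    unfolding h_def by (simp add: integrable_noise_mult cov c_def prob_space)
  have "vanishes_in_prob (\<lambda>n \<omega>. (1 / real n) *\<^sub>R (\<Sum>l<n. h (x (Suc l) \<omega>)))"
  proof (rule vanishes_in_prob_orthogonal_average[OF _ sq])
    fix l
    have "expectation (\<lambda>\<omega>. (h (x (Suc l) \<omega>))\<^sup>2)
        \<le> expectation (\<lambda>\<omega>. 2 * (x (Suc l) \<omega> $ i ^ 4 + x (Suc l) \<omega> $ j ^ 4) + 2 * c\<^sup>2)"
      using bound by (intro integral_mono sq) (auto simp: integrable_fourth_moment)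
    also have "\<dots> \<le> 4 * \<kappa> + 2 * c\<^sup>2"
      using fourth_moment_le[of "Suc l" i] fourth_moment_le[of "Suc l" j] by (simp add: integrable_fourth_moment prob_space)
    finally show "expectation (\<lambda>\<omega>. (h (x (Suc l) \<omega>))\<^sup>2) \<le> 4 * \<kappa> + 2 * c\<^sup>2" .
  next
    fix l m :: nat assume "l < m"
    \<comment> \<open>The later noise vector is put first, in the role of the factor independent of
      the past.\<close>
    have "expectation (\<lambda>\<omega>. h (x (Suc m) \<omega>) * h (x (Suc l) \<omega>)) = 0"
    proof (subst expectation_noise_past[of "\<lambda>f. h (f (Suc l))" "Suc l" h "Suc m"])
      show "(\<lambda>f. h (f (Suc l))) \<in> borel_measurable (Pi\<^sub>M {1..Suc l} (\<lambda>_. borel))"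
        by (intro measurable_compose[OF measurable_component_singleton]) auto
    qed (auto simp: \<open>l < m\<close> int h0)
    thus "expectation (\<lambda>\<omega>. h (x (Suc l) \<omega>) * h (x (Suc m) \<omega>)) = 0" by (simp add: mult.commute)
  qed simp
  thus "vanishes_in_prob (\<lambda>n \<omega>. running_mean (\<lambda>l. outer_product (x (Suc l) \<omega>) (x (Suc l) \<omega>)
      - s *\<^sub>R mat 1) n $ i $ j)"
    unfolding running_mean_nth
    by (simp add: running_mean_def outer_product_def mat_def h_def c_def if_distrib cong: if_cong)
qed

lemma integrable_norm_noise_sq: "1 \<le> n \<Longrightarrow> integrable M (\<lambda>\<omega>. (norm (x n \<omega>))\<^sup>2)"
  unfolding power2_norm_eq_inner inner_vec_def
  using integrable_noise_mult by (intro Bochner_Integration.integrable_sum) simp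

lemma expectation_norm_noise_sq: "1 \<le> n \<Longrightarrow> expectation (\<lambda>\<omega>. (norm (x n \<omega>))\<^sup>2) = CARD('n) * s"
  unfolding power2_norm_eq_inner inner_vec_def
  by (subst Bochner_Integration.integral_sum) (simp_all add: integrable_noise_mult cov)

end

locale stable_autoregression = white_noise M x s \<kappa>
  for M :: "'a measure" and x :: "nat \<Rightarrow> 'a \<Rightarrow> real^'n" and s \<kappa> :: real +
  fixes A :: "real^'n^'n"
  assumes sym: "transpose A = A" and contraction: "onorm ((*v) A) < 1"
begin

abbreviation "a \<equiv> onorm ((*v) A)"

lemma a_nonneg: "0 \<le> a"
  by (rule onorm_pos_le[OF matrix_vector_mul_bounded_linear])

lemma norm_A_le: "norm (A *v v) \<le> a * norm v"
  by (rule onorm[OF matrix_vector_mul_bounded_linear])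

text \<open>Nothing is assumed about the initial state of the given process, whereas the process started
  at zero has finite moments and is independent of the future noise.\<close>

definition w :: "nat \<Rightarrow> 'a \<Rightarrow> real^'n" where
  "w n \<omega> = linear_response A n (\<lambda>l. x l \<omega>)"

lemma w_0 [simp]: "w 0 \<omega> = 0"
  and w_Suc: "w (Suc n) \<omega> = A *v w n \<omega> + x (Suc n) \<omega>"
  by (simp_all add: w_def)

lemma measurable_w [measurable]: "w n \<in> borel_measurable M"
proof (induction n)
  case 0
  have "w 0 = (\<lambda>_. 0)" by auto
  thus ?case by simp
next
  case (Suc n)
  note [measurable] = this measurable_noise[of "Suc n", simplified]
  show ?case unfolding w_Suc[abs_def] by measurable
qed

text \<open>The fixed point of the map sending b to \<open>a * b + CARD('n) * s / (1 - a)\<close>,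
  which bounds the growth of the second moment in one step.\<close>

definition state_bound :: real where "state_bound = CARD('n) * s / (1 - a)\<^sup>2"

lemma w_L2:
  "integrable M (\<lambda>\<omega>. (norm (w n \<omega>))\<^sup>2) \<and> expectation (\<lambda>\<omega>. (norm (w n \<omega>))\<^sup>2) \<le> state_bound"
proof (induction n)
  case 0
  have "0 \<le> expectation (\<lambda>\<omega>. (norm (x 1 \<omega>))\<^sup>2)" by (rule Bochner_Integration.integral_nonneg) simp
  hence "0 \<le> CARD('n) * s" using expectation_norm_noise_sq[OF order_refl] by metis
  thus ?case by (simp add: state_bound_def)
next
  case (Suc n)
  let ?b = "\<lambda>\<omega>. a * (norm (w n \<omega>))\<^sup>2 + (norm (x (Suc n) \<omega>))\<^sup>2 / (1 - a)"
  \<comment> \<open>Convexity of the square, applied to the weights \<open>a\<close> and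
    \<open>1 - a\<close> at the points \<open>u\<close> and \<open>v / (1 - a)\<close>. The
    resulting bound has no cross term.\<close>
  have convex: "(a * u + v)\<^sup>2 \<le> a * u\<^sup>2 + v\<^sup>2 / (1 - a)" for u v :: real
  proof -
    have "a * u\<^sup>2 + v\<^sup>2 / (1 - a) - (a * u + v)\<^sup>2 = a / (1 - a) * ((1 - a) * u - v)\<^sup>2"
      using contraction by (simp add: power2_eq_square field_simps)
    also have "\<dots> \<ge> 0" using a_nonneg contraction by simp
    finally show ?thesis by simp
  qed
  have le: "(norm (w (Suc n) \<omega>))\<^sup>2 \<le> ?b \<omega>" for \<omega>
  proof -
    have "norm (w (Suc n) \<omega>) \<le> a * norm (w n \<omega>) + norm (x (Suc n) \<omega>)"
      unfolding w_Suc using norm_triangle_ineq norm_A_le by (meson add_right_mono order_trans)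
    hence "(norm (w (Suc n) \<omega>))\<^sup>2 \<le> (a * norm (w n \<omega>) + norm (x (Suc n) \<omega>))\<^sup>2"
      by (intro power_mono) auto
    thus ?thesis using convex order_trans by blast
  qed
  have int: "integrable M ?b" using Suc integrable_norm_noise_sq[of "Suc n"] by simp
  have nn: "0 \<le> ?b \<omega>" for \<omega> using le[of \<omega>] by (meson order_trans zero_le_power2)
  have i2: "integrable M (\<lambda>\<omega>. (norm (w (Suc n) \<omega>))\<^sup>2)"
    using int by (rule Bochner_Integration.integrable_bound) (use le nn in auto)
  have "expectation (\<lambda>\<omega>. (norm (w (Suc n) \<omega>))\<^sup>2) \<le> expectation ?b"
    using i2 int le by (rule integral_mono)
  also have "\<dots> = a * expectation (\<lambda>\<omega>. (norm (w n \<omega>))\<^sup>2) + CARD('n) * s / (1 - a)"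
    using Suc integrable_norm_noise_sq[of "Suc n"] by (simp add: expectation_norm_noise_sq)
  also have "\<dots> \<le> a * state_bound + CARD('n) * s / (1 - a)"
    using Suc a_nonneg by (intro add_right_mono mult_left_mono) auto
  also have "CARD('n) * s / (1 - a) = (1 - a) * state_bound"
    using contraction by (simp add: state_bound_def power2_eq_square)
  also have "a * state_bound + (1 - a) * state_bound = state_bound" by (simp add: algebra_simps)
  finally show ?case using i2 by simp
qed

lemma integrable_w_nth_sq: "integrable M (\<lambda>\<omega>. (w n \<omega> $ i)\<^sup>2)"
  and expectation_w_nth_sq_le: "expectation (\<lambda>\<omega>. (w n \<omega> $ i)\<^sup>2) \<le> state_bound"
proof -
  have le: "(w n \<omega> $ i)\<^sup>2 \<le> (norm (w n \<omega>))\<^sup>2" for \<omega>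
    using component_le_norm_cart[of "w n \<omega>" i] by (metis abs_ge_zero power2_abs power_mono)
  show int: "integrable M (\<lambda>\<omega>. (w n \<omega> $ i)\<^sup>2)"
    using conjunct1[OF w_L2] by (rule Bochner_Integration.integrable_bound) (use le in auto)
  show "expectation (\<lambda>\<omega>. (w n \<omega> $ i)\<^sup>2) \<le> state_bound"
    using integral_mono[OF int _ le] w_L2 by (meson order_trans)
qed

lemma norm_w_L1: "integrable M (\<lambda>\<omega>. norm (w n \<omega>))" "expectation (\<lambda>\<omega>. norm (w n \<omega>)) \<le> 1 + state_bound"
proof -
  have le: "norm (w n \<omega>) \<le> 1 + (norm (w n \<omega>))\<^sup>2" for \<omega>
    using sum_squares_bound[of "norm (w n \<omega>)" 1] norm_ge_zero[of "w n \<omega>"] by (simp, linarith)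
  show int: "integrable M (\<lambda>\<omega>. norm (w n \<omega>))"
    by (rule Bochner_Integration.integrable_bound[of M "\<lambda>\<omega>. 1 + (norm (w n \<omega>))\<^sup>2"])
      (use le w_L2 in auto)
  have "expectation (\<lambda>\<omega>. norm (w n \<omega>)) \<le> expectation (\<lambda>\<omega>. 1 + (norm (w n \<omega>))\<^sup>2)"
    by (intro integral_mono int le) (use w_L2 in auto)
  also have "\<dots> \<le> 1 + state_bound" using w_L2[of n] by (simp add: prob_space)
  finally show "expectation (\<lambda>\<omega>. norm (w n \<omega>)) \<le> 1 + state_bound" .
qed

text \<open>This is the boundary term left by telescoping; its norm has expectation at most
  \<open>state_bound / n\<close>.\<close>

lemma vanishes_in_prob_boundary:
  "vanishes_in_prob (\<lambda>n \<omega>. (1 / real n) *\<^sub>R outer_product (w n \<omega>) (w n \<omega>))"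
proof -
  have "vanishes_in_prob (\<lambda>n \<omega>. (norm (w n \<omega>))\<^sup>2 / n)"
  proof (rule vanishes_in_prob_L1)
    show "(\<lambda>n. expectation (\<lambda>\<omega>. (norm (w n \<omega>))\<^sup>2 / n)) \<longlonglongrightarrow> 0"
    proof (rule tendsto_sandwich[OF _ _ tendsto_const lim_const_over_n[of state_bound]])
      show "\<forall>\<^sub>F n in sequentially. expectation (\<lambda>\<omega>. (norm (w n \<omega>))\<^sup>2 / n) \<le> state_bound / n"
        using w_L2 by (auto intro!: always_eventually divide_right_mono)
    qed simp
  qed (use w_L2 in auto)
  thus ?thesis
    by (rule vanishes_in_prob_bound[of _ _ 1]) (simp add: norm_outer_product power2_eq_square)
qed

text \<open>For \<open>l < m\<close> the noise at time \<open>m + k\<close> has mean zero and is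
  independent of all other factors of \<open>u l \<omega> * u m \<omega>\<close>, so the summands
  are orthogonal. Since \<open>k\<close> is positive, noise and state within one summand are
  independent too, which bounds the second moments.\<close>

lemma vanishes_in_prob_noise_state:
  assumes "1 \<le> k"
  shows "vanishes_in_prob (\<lambda>n \<omega>. running_mean (\<lambda>l. outer_product (x (l + k) \<omega>) (w l \<omega>)) n)"
proof (intro vanishes_in_prob_vec)
  fix i j :: 'n
  define u where "u l \<omega> = x (l + k) \<omega> $ i * w l \<omega> $ j" for l \<omega>
  have [measurable]: "x (l + k) \<in> borel_measurable M" for l using assms by (intro measurable_noise) simp
  have [measurable]: "u l \<in> borel_measurable M" for l unfolding u_def[abs_def] by measurable
  have lr: "(\<lambda>f. linear_response A l f $ j) \<in> borel_measurable (Pi\<^sub>M {1..p} (\<lambda>_. borel))"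
    if "l \<le> p" for l p
    using measurable_linear_response[OF that, of A] by measurable
  have u2: "integrable M (\<lambda>\<omega>. (u l \<omega>)\<^sup>2) \<and> expectation (\<lambda>\<omega>. (u l \<omega>)\<^sup>2) \<le> s * state_bound" for l
  proof -
    have *: "(\<lambda>f. (linear_response A l f $ j)\<^sup>2) \<in> borel_measurable (Pi\<^sub>M {1..l} (\<lambda>_. borel))"
      by (intro borel_measurable_power lr) simp
    have eq: "(u l \<omega>)\<^sup>2 = (x (l + k) \<omega> $ i)\<^sup>2 * (linear_response A l (\<lambda>n. x n \<omega>) $ j)\<^sup>2" for \<omega>
      by (simp add: u_def w_def power_mult_distrib)
    have l: "1 \<le> l + k" "l < l + k" using assms by auto
    have wi: "integrable M (\<lambda>\<omega>. (linear_response A l (\<lambda>n. x n \<omega>) $ j)\<^sup>2)"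
      using integrable_w_nth_sq[of l j] by (simp add: w_def)
    have r: "(linear_response A l (restrict f {1..l}) $ j)\<^sup>2 = (linear_response A l f $ j)\<^sup>2" for f
      by (simp only: linear_response_restrict[OF order_refl])
    have "integrable M (\<lambda>\<omega>. (u l \<omega>)\<^sup>2)"
      unfolding eq by (rule integrable_noise_past[OF * r _ l(2) integrable_noise_sq[OF l(1), of i] wi])
        simp
    moreover have "expectation (\<lambda>\<omega>. (u l \<omega>)\<^sup>2) = s * expectation (\<lambda>\<omega>. (w l \<omega> $ j)\<^sup>2)"
      unfolding eq
      by (subst expectation_noise_past[OF * r _ l(2) integrable_noise_sq[OF l(1), of i] wi])
        (use cov[OF l(1), of i i] in \<open>simp_all add: w_def power2_eq_square\<close>)
    moreover have "0 \<le> s"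
      using cov[OF l(1), of i i] Bochner_Integration.integral_nonneg[of M "\<lambda>\<omega>. x (l + k) \<omega> $ i * x (l + k) \<omega> $ i"]
      by simp
    ultimately show ?thesis using expectation_w_nth_sq_le[of l j] by (simp add: mult_left_mono)
  qed
  have "vanishes_in_prob (\<lambda>n \<omega>. (1 / real n) *\<^sub>R (\<Sum>l<n. u l \<omega>))"
  proof (rule vanishes_in_prob_orthogonal_average)
    fix l m :: nat assume "l < m"
    let ?G = "\<lambda>f. f (l + k) $ i * linear_response A l f $ j * linear_response A m f $ j"
    \<comment> \<open>The last time before \<open>m + k\<close>. It is at least \<open>m\<close>
      because \<open>1 \<le> k\<close>, and at least \<open>l + k\<close> because
      \<open>l < m\<close>.\<close>
    define p where "p = m + k - 1"
    have p: "l \<le> p" "m \<le> p" "l + k \<in> {1..p}" "p < m + k"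
      using \<open>l < m\<close> assms by (auto simp: p_def)
    have [measurable]: "(\<lambda>f. f (l + k)) \<in> borel_measurable (Pi\<^sub>M {1..p} (\<lambda>_. borel :: (real^'n) measure))"
      using p by (intro measurable_component_singleton) auto
    note [measurable] = lr[OF p(1)] lr[OF p(2)]
    have G: "?G \<in> borel_measurable (Pi\<^sub>M {1..p} (\<lambda>_. borel))" by measurable
    have r: "?G (restrict f {1..p}) = ?G f" for f
      using p by (simp add: linear_response_restrict del: One_nat_def)
    have "integrable M (\<lambda>\<omega>. u l \<omega> * w m \<omega> $ j)"
      by (rule integrable_mult_of_square_integrable[OF _ _ conjunct1[OF u2] integrable_w_nth_sq]) auto
    hence int: "integrable M (\<lambda>\<omega>. ?G (\<lambda>n. x n \<omega>))" by (simp add: u_def w_def)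
    have "expectation (\<lambda>\<omega>. x (m + k) \<omega> $ i * ?G (\<lambda>n. x n \<omega>)) = 0"
      by (subst expectation_noise_past[OF G r, of "\<lambda>v. v $ i"])
        (use int p assms in \<open>simp_all add: integrable_noise mean\<close>)
    thus "expectation (\<lambda>\<omega>. u l \<omega> * u m \<omega>) = 0"
      by (simp add: u_def w_def ac_simps)
  qed (use u2 in auto)
  thus "vanishes_in_prob (\<lambda>n \<omega>. running_mean (\<lambda>l. outer_product (x (l + k) \<omega>) (w l \<omega>)) n $ i $ j)"
    unfolding running_mean_nth by (simp add: running_mean_def outer_product_def u_def)
qed

text \<open>Unrolling the recursion expresses both lagged averages through \<open>P\<close> and the
  noise-state averages \<open>C\<close>. The latter vanish, and \<open>stein_perturbation\<close>
  evaluates the part in \<open>P\<close> once its defect \<open>E\<close> is known to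
  vanish.\<close>

lemma vanishes_in_prob_lag_difference_zero_start:
  "vanishes_in_prob (\<lambda>n \<omega>. running_mean (\<lambda>l. outer_product (w (l + 1) \<omega>) (w l \<omega>)) n
     - running_mean (\<lambda>l. outer_product (w (l + 3) \<omega>) (w l \<omega>)) n - s *\<^sub>R A)"
proof -
  define C where "C k n \<omega> = running_mean (\<lambda>l. outer_product (x (l + k) \<omega>) (w l \<omega>)) n" for k n \<omega>
  define P where "P n \<omega> = running_mean (\<lambda>l. outer_product (w l \<omega>) (w l \<omega>)) n" for n \<omega>
  define Q where "Q n \<omega> = running_mean (\<lambda>l. outer_product (x (Suc l) \<omega>) (x (Suc l) \<omega>) - s *\<^sub>R mat 1) n" for n \<omega>
  define T where "T n \<omega> = (1 / real n) *\<^sub>R outer_product (w n \<omega>) (w n \<omega>)" for n \<omega>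
  define E where "E n \<omega> = P n \<omega> - A ** P n \<omega> ** A - s *\<^sub>R mat 1" for n \<omega>
  note ml = linear_matrix_mult_left[of A] and mr = linear_matrix_mult_right[of A]
  have transpose_outer: "outer_product v u = transpose (outer_product u v)" for u v :: "real^'n"
    by (simp add: outer_product_def transpose_def vec_eq_iff mult.commute)
  have lt: "linear (transpose :: real^'n^'n \<Rightarrow> _)"
    by (rule linearI) (simp_all add: transpose_def vec_eq_iff)
  have vC: "vanishes_in_prob (C k)" if "1 \<le> k" for k
    unfolding C_def[abs_def] by (rule vanishes_in_prob_noise_state[OF that])
  have vQ: "vanishes_in_prob Q" unfolding Q_def[abs_def] by (rule vanishes_in_prob_noise_covariance)
  have vT: "vanishes_in_prob T" unfolding T_def[abs_def] by (rule vanishes_in_prob_boundary)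
  have E: "E n \<omega> = A ** transpose (C 1 n \<omega>) + C 1 n \<omega> ** A + Q n \<omega> - T n \<omega>" if "0 < n" for n \<omega>
  proof -
    \<comment> \<open>One step of the recursion on both factors. The noise covariance is split into
      its centred part and its mean so that the former averages to \<open>Q\<close>.\<close>
    have step: "outer_product (w (Suc l) \<omega>) (w (Suc l) \<omega>)
        = A ** outer_product (w l \<omega>) (w l \<omega>) ** A + A ** transpose (outer_product (x (l + 1) \<omega>) (w l \<omega>))
          + outer_product (x (l + 1) \<omega>) (w l \<omega>) ** A
          + (outer_product (x (Suc l) \<omega>) (x (Suc l) \<omega>) - s *\<^sub>R mat 1) + s *\<^sub>R mat 1" for l
      by (simp add: w_Suc outer_product_add_left outer_product_add_right outer_product_matrix_left
          outer_product_matrix_right sym matrix_mul_assoc linear_add[OF mr]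
          transpose_outer[of "w l \<omega>" "x (Suc l) \<omega>"] linear_add[OF ml])
    \<comment> \<open>The average of the increments telescopes, and the initial term is zero because
      \<open>w 0 \<omega> = 0\<close>.\<close>
    have "T n \<omega> = running_mean (\<lambda>l. outer_product (w (Suc l) \<omega>) (w (Suc l) \<omega>) - outer_product (w l \<omega>) (w l \<omega>)) n"
      by (subst running_mean_telescope[of "\<lambda>l. outer_product (w l \<omega>) (w l \<omega>)"])
        (simp add: T_def outer_product_def vec_eq_iff)
    also have "\<dots> = A ** P n \<omega> ** A + A ** transpose (C 1 n \<omega>) + C 1 n \<omega> ** A + Q n \<omega> + s *\<^sub>R mat 1 - P n \<omega>"
      unfolding running_mean_diff step running_mean_add
        running_mean_linear[OF ml] running_mean_linear[OF mr] running_mean_linear[OF lt]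
      by (simp add: P_def C_def Q_def running_mean_diff running_mean_const[OF that])
    finally show ?thesis by (simp add: E_def)
  qed
  have vE: "vanishes_in_prob E"
  proof (rule vanishes_in_prob_cong)
    show "vanishes_in_prob (\<lambda>n \<omega>. A ** transpose (C 1 n \<omega>) + C 1 n \<omega> ** A + Q n \<omega> - T n \<omega>)"
      by (intro vanishes_in_prob_diff vanishes_in_prob_add vQ vT vC
          vanishes_in_prob_linear[OF ml] vanishes_in_prob_linear[OF mr] vanishes_in_prob_linear[OF lt]) simp_all
  qed (rule E)
  have v1: "vanishes_in_prob (\<lambda>n \<omega>. A ** P n \<omega> - A ** (A ** (A ** P n \<omega>)) - s *\<^sub>R A)"
    by (rule vanishes_in_prob_bound[OF vE]) (rule stein_perturbation[OF sym contraction E_def])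
  have v2: "vanishes_in_prob (\<lambda>n \<omega>. C 1 n \<omega> - (A ** (A ** C 1 n \<omega> + C 2 n \<omega>) + C 3 n \<omega>))"
    by (intro vanishes_in_prob_diff vanishes_in_prob_add vC vanishes_in_prob_linear[OF ml]) simp_all
  show ?thesis
  proof (rule vanishes_in_prob_cong[OF vanishes_in_prob_add[OF v1 v2]])
    fix n \<omega>
    have s1: "outer_product (w (l + 1) \<omega>) (w l \<omega>)
        = A ** outer_product (w l \<omega>) (w l \<omega>) + outer_product (x (l + 1) \<omega>) (w l \<omega>)" for l
      by (simp add: w_Suc outer_product_add_left outer_product_matrix_left)
    \<comment> \<open>Three steps of the recursion in the left factor only; every noise vector that
      appears is later than time \<open>l\<close>.\<close>
    have s3: "outer_product (w (l + 3) \<omega>) (w l \<omega>)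
        = A ** (A ** (A ** outer_product (w l \<omega>) (w l \<omega>) + outer_product (x (l + 1) \<omega>) (w l \<omega>))
          + outer_product (x (l + 2) \<omega>) (w l \<omega>)) + outer_product (x (l + 3) \<omega>) (w l \<omega>)" for l
      by (simp add: numeral_3_eq_3 numeral_2_eq_2 w_Suc outer_product_add_left outer_product_matrix_left)
    show "running_mean (\<lambda>l. outer_product (w (l + 1) \<omega>) (w l \<omega>)) n
        - running_mean (\<lambda>l. outer_product (w (l + 3) \<omega>) (w l \<omega>)) n - s *\<^sub>R A
      = A ** P n \<omega> - A ** (A ** (A ** P n \<omega>)) - s *\<^sub>R A
        + (C 1 n \<omega> - (A ** (A ** C 1 n \<omega> + C 2 n \<omega>) + C 3 n \<omega>))"
      unfolding s1 s3 running_mean_add running_mean_linear[OF ml] C_def[symmetric] P_def[symmetric]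
      by (simp add: linear_add[OF ml])
  qed
qed

text \<open>The difference of the two processes is propagated by \<open>A\<close> alone and decays
  geometrically. The summands therefore differ by at most \<open>U \<omega> * g l \<omega>\<close>,
  where \<open>U\<close> depends only on the initial state and the expectations of
  \<open>g l\<close> are summable.\<close>

lemma vanishes_in_prob_initial_state:
  assumes y0: "y 0 \<in> borel_measurable M"
    and y: "\<And>n \<omega>. \<omega> \<in> space M \<Longrightarrow> y (Suc n) \<omega> = A *v y n \<omega> + x (Suc n) \<omega>"
  shows "vanishes_in_prob (\<lambda>n \<omega>. running_mean (\<lambda>l. outer_product (y (l + k) \<omega>) (y l \<omega>)) n
     - running_mean (\<lambda>l. outer_product (w (l + k) \<omega>) (w l \<omega>)) n)"
proof -
  \<comment> \<open>The two terms absorb the contributions that are linear and quadratic in the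
    initial state.\<close>
  define U where "U \<omega> = norm (y 0 \<omega>) + (norm (y 0 \<omega>))\<^sup>2" for \<omega>
  define g where "g l \<omega> = a ^ l * (norm (w l \<omega>) + norm (w (l + k) \<omega>) + 1)" for l \<omega>
  have g0: "0 \<le> g l \<omega>" for l \<omega> using a_nonneg by (simp add: g_def)
  have [measurable]: "U \<in> borel_measurable M" using y0 unfolding U_def[abs_def] by measurable
  have gi: "integrable M (g l)" for l
    unfolding g_def[abs_def] by (simp add: norm_w_L1)
  \<comment> \<open>The constant is two bounds \<open>1 + state_bound\<close> for the norms of the
    states plus the summand 1 in \<open>g\<close>.\<close>
  have ge: "expectation (g l) \<le> a ^ l * (2 * state_bound + 3)" for l
    using norm_w_L1[of l] norm_w_L1[of "l + k"] a_nonneg unfolding g_def[abs_def]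
    by (simp add: prob_space mult_left_mono)
  have "vanishes_in_prob (\<lambda>n \<omega>. running_mean (\<lambda>l. g l \<omega>) n)"
  proof (rule vanishes_in_prob_L1)
    have B0: "0 \<le> state_bound" using w_L2[of 0] by simp
    have le: "expectation (\<lambda>\<omega>. running_mean (\<lambda>l. g l \<omega>) n) \<le> (2 * state_bound + 3) / (1 - a) / n" for n
    proof -
      have "expectation (\<lambda>\<omega>. running_mean (\<lambda>l. g l \<omega>) n) = (\<Sum>l<n. expectation (g l)) / n"
        by (simp add: running_mean_def gi)
      also have "\<dots> \<le> (\<Sum>l<n. a ^ l * (2 * state_bound + 3)) / n"
        by (intro divide_right_mono sum_mono ge) simp
      also have "\<dots> = (\<Sum>l<n. a ^ l) * (2 * state_bound + 3) / n" by (simp add: sum_distrib_right)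
      also have "\<dots> \<le> 1 / (1 - a) * (2 * state_bound + 3) / n"
        using contraction a_nonneg B0
        by (intro divide_right_mono mult_right_mono)
          (simp_all add: sum_gp_strict divide_right_mono)
      finally show ?thesis by simp
    qed
    show "(\<lambda>n. expectation (\<lambda>\<omega>. running_mean (\<lambda>l. g l \<omega>) n)) \<longlonglongrightarrow> 0"
    proof (rule tendsto_sandwich[OF _ _ tendsto_const lim_const_over_n[of "(2 * state_bound + 3) / (1 - a)"]])
      show "\<forall>\<^sub>F n in sequentially. 0 \<le> expectation (\<lambda>\<omega>. running_mean (\<lambda>l. g l \<omega>) n)"
        by (intro always_eventually allI Bochner_Integration.integral_nonneg)
          (simp add: running_mean_def sum_nonneg g0)
    qed (intro always_eventually allI le)
  qed (auto simp: running_mean_def gi g0 sum_nonneg)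
  from vanishes_in_prob_mult[OF _ this, of U]
  have v: "vanishes_in_prob (\<lambda>n \<omega>. U \<omega> * running_mean (\<lambda>l. g l \<omega>) n)" by simp
  have d: "norm (y n \<omega> - w n \<omega>) \<le> a ^ n * norm (y 0 \<omega>)" if "\<omega> \<in> space M" for n \<omega>
  proof (induction n)
    case (Suc n)
    have "y (Suc n) \<omega> - w (Suc n) \<omega> = A *v (y n \<omega> - w n \<omega>)"
      by (simp add: y[OF that] w_Suc matrix_vector_mult_diff_distrib)
    also have "norm \<dots> \<le> a * norm (y n \<omega> - w n \<omega>)" by (rule norm_A_le)
    also have "\<dots> \<le> a * (a ^ n * norm (y 0 \<omega>))" using Suc a_nonneg by (rule mult_left_mono)
    finally show ?case by (simp add: mult.assoc)
  qed simp
  have outer_le: "norm (outer_product (y (l + k) \<omega>) (y l \<omega>) - outer_product (w (l + k) \<omega>) (w l \<omega>))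
      \<le> U \<omega> * g l \<omega>" if "\<omega> \<in> space M" for l \<omega>
  proof -
    let ?d = "\<lambda>n. y n \<omega> - w n \<omega>" and ?u = "norm (y 0 \<omega>)"
    have "a ^ k \<le> 1" using a_nonneg contraction by (simp add: power_le_one)
    hence "a ^ (l + k) \<le> a ^ l"
      unfolding power_add using a_nonneg by (simp add: mult_left_le)
    hence dk: "norm (?d (l + k)) \<le> a ^ l * ?u"
      using d[OF that, of "l + k"] by (meson mult_right_mono norm_ge_zero order_trans)
    \<comment> \<open>In the quadratic term the decay of one factor suffices, so the other is
      bounded uniformly in \<open>l\<close>.\<close>
    have dk1: "norm (?d (l + k)) \<le> ?u"
      using d[OF that, of "l + k"] a_nonneg contraction
        mult_right_mono[of "a ^ (l + k)" 1 ?u] power_le_one[of a "l + k"] by simp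
    have split: "outer_product (y (l + k) \<omega>) (y l \<omega>) - outer_product (w (l + k) \<omega>) (w l \<omega>)
        = outer_product (?d (l + k)) (w l \<omega>) + outer_product (w (l + k) \<omega>) (?d l)
          + outer_product (?d (l + k)) (?d l)"
      by (simp add: outer_product_def vec_eq_iff algebra_simps)
    have "norm (outer_product (y (l + k) \<omega>) (y l \<omega>) - outer_product (w (l + k) \<omega>) (w l \<omega>))
        \<le> norm (?d (l + k)) * norm (w l \<omega>) + norm (w (l + k) \<omega>) * norm (?d l) + norm (?d (l + k)) * norm (?d l)"
      unfolding split norm_outer_product[symmetric]
      by (meson add_right_mono norm_triangle_ineq order_trans)
    also have "\<dots> \<le> (a ^ l * ?u) * norm (w l \<omega>) + norm (w (l + k) \<omega>) * (a ^ l * ?u) + ?u * (a ^ l * ?u)"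
      using d[OF that, of l] dk dk1 a_nonneg by (intro add_mono mult_mono) auto
    also have "\<dots> \<le> U \<omega> * g l \<omega>"
    proof -
      have "U \<omega> * g l \<omega> - ((a ^ l * ?u) * norm (w l \<omega>) + norm (w (l + k) \<omega>) * (a ^ l * ?u) + ?u * (a ^ l * ?u))
        = a ^ l * (?u\<^sup>2 * (norm (w l \<omega>) + norm (w (l + k) \<omega>)) + ?u)"
        by (simp add: U_def g_def power2_eq_square algebra_simps)
      also have "\<dots> \<ge> 0" using a_nonneg by simp
      finally show ?thesis by simp
    qed
    finally show ?thesis .
  qed
  show ?thesis
  proof (rule vanishes_in_prob_bound[OF v, of _ 1])
    fix n \<omega> assume \<omega>: "\<omega> \<in> space M"
    have "norm (running_mean (\<lambda>l. outer_product (y (l + k) \<omega>) (y l \<omega>) - outer_product (w (l + k) \<omega>) (w l \<omega>)) n)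
        \<le> running_mean (\<lambda>l. U \<omega> * g l \<omega>) n"
      unfolding running_mean_def
      by (simp, intro divide_right_mono sum_norm_le outer_le \<omega>) simp
    also have "\<dots> = U \<omega> * running_mean (\<lambda>l. g l \<omega>) n"
      by (simp add: running_mean_def sum_distrib_left)
    finally show "norm (running_mean (\<lambda>l. outer_product (y (l + k) \<omega>) (y l \<omega>)) n
        - running_mean (\<lambda>l. outer_product (w (l + k) \<omega>) (w l \<omega>)) n)
      \<le> 1 * norm (U \<omega> * running_mean (\<lambda>l. g l \<omega>) n)"
      by (simp add: running_mean_diff)
  qed
qed

lemma vanishes_in_prob_lag_difference:
  assumes y0: "y 0 \<in> borel_measurable M"
    and y: "\<And>n \<omega>. \<omega> \<in> space M \<Longrightarrow> y (Suc n) \<omega> = A *v y n \<omega> + x (Suc n) \<omega>"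
  shows "vanishes_in_prob (\<lambda>n \<omega>. lag_cov (\<lambda>l. y l \<omega>) 1 n - lag_cov (\<lambda>l. y l \<omega>) 3 n - s *\<^sub>R A)"
proof (rule vanishes_in_prob_cong)
  note init = vanishes_in_prob_initial_state[OF y0 y]
  show "vanishes_in_prob (\<lambda>n \<omega>.
      running_mean (\<lambda>l. outer_product (w (l + 1) \<omega>) (w l \<omega>)) n
        - running_mean (\<lambda>l. outer_product (w (l + 3) \<omega>) (w l \<omega>)) n - s *\<^sub>R A
      + (running_mean (\<lambda>l. outer_product (y (l + 1) \<omega>) (y l \<omega>)) n
        - running_mean (\<lambda>l. outer_product (w (l + 1) \<omega>) (w l \<omega>)) n)
      - (running_mean (\<lambda>l. outer_product (y (l + 3) \<omega>) (y l \<omega>)) n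
        - running_mean (\<lambda>l. outer_product (w (l + 3) \<omega>) (w l \<omega>)) n))"
    by (intro vanishes_in_prob_diff vanishes_in_prob_add init vanishes_in_prob_lag_difference_zero_start)
qed (simp add: lag_cov_def running_mean_def)

end

section \<open>Linear separability of the features\<close>

theorem theorem1:
  fixes A :: "real^'n^'n"
    and \<sigma> :: real
    and M :: "'a measure"
    and x y :: "nat \<Rightarrow> 'a \<Rightarrow> real^'n"
    and S :: "'n set"
    and D L :: int
  assumes sym: "transpose A = A"
    and nonneg: "\<And>i j. 0 \<le> A $ i $ j"
    and stable: "spectral_radius A < 1"
    and sigma: "0 < \<sigma>"
    and prob: "prob_space M"
    and init: "y 0 \<in> borel_measurable M"
    and noise_normal: "\<And>n. 1 \<le> n \<Longrightarrow> prob_space.multivariate_normal M (x n) 0 (\<sigma>\<^sup>2 *\<^sub>R mat 1)"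
    and noise_indep: "prob_space.indep_vars M (\<lambda>_. borel) x {1..}"
    and process: "\<And>n \<omega>. \<omega> \<in> space M \<Longrightarrow> y (Suc n) \<omega> = A *v y n \<omega> + x (Suc n) \<omega>"
    and observed: "S \<noteq> {}"
    and lags: "D \<le> 1" "3 \<le> L"
    and dim: "int CARD('m::{finite,linorder}) = L - D + 1"
  shows "\<exists>f :: real^('m::{finite,linorder}) \<Rightarrow> real. affine_map f \<and>
    (\<forall>i\<in>S. \<forall>j\<in>S. i \<noteq> j \<longrightarrow>
      (A $ i $ j \<noteq> 0 \<longrightarrow>
        (\<lambda>n. measure M {\<omega> \<in> space M. f (feature D (\<lambda>l. y l \<omega>) n i j) > 0}) \<longlonglongrightarrow> 1) \<and>
      (A $ i $ j = 0 \<longrightarrow>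
        (\<lambda>n. measure M {\<omega> \<in> space M. f (feature D (\<lambda>l. y l \<omega>) n i j) \<le> 0}) \<longlonglongrightarrow> 1))"
proof -
  interpret prob_space M by (rule prob)
  define \<kappa> where "\<kappa> = (\<integral>t. normal_density 0 \<sigma> t * t ^ 4 \<partial>lborel)"
  note moments = isotropic_normal_low_moments[OF noise_normal sigma]
  interpret stable_autoregression M x "\<sigma>\<^sup>2" \<kappa> A
    using noise_indep moments sym symmetric_onorm_le_spectral_radius[OF sym] stable
    by unfold_locales (simp_all add: \<kappa>_def)
  have y_meas [measurable]: "y n \<in> borel_measurable M" for n
  proof (induction n)
    case (Suc n)
    have "(\<lambda>\<omega>. A *v y n \<omega> + x (Suc n) \<omega>) \<in> borel_measurable M"
      by (intro borel_measurable_add borel_measurable_matrix_vector_mult Suc measurable_noise) simp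
    thus ?case by (simp cong: measurable_cong add: process)
  qed (rule init)
  define Y where "Y i j n \<omega> = (lag_cov (\<lambda>l. y l \<omega>) 1 n - lag_cov (\<lambda>l. y l \<omega>) 3 n) $ i $ j" for i j n \<omega>
  have Y_meas [measurable]: "Y i j n \<in> borel_measurable M" for i j n
    unfolding Y_def[abs_def] by (simp add: lag_cov_def outer_product_def)
  have Y_lim: "vanishes_in_prob (\<lambda>n \<omega>. Y i j n \<omega> - \<sigma>\<^sup>2 * A $ i $ j)" for i j
  proof (rule vanishes_in_prob_bound[OF vanishes_in_prob_lag_difference[OF init process], of _ 1])
    fix n \<omega>
    let ?Z = "lag_cov (\<lambda>l. y l \<omega>) 1 n - lag_cov (\<lambda>l. y l \<omega>) 3 n - \<sigma>\<^sup>2 *\<^sub>R A"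
    have "Y i j n \<omega> - \<sigma>\<^sup>2 * A $ i $ j = ?Z $ i $ j" by (simp add: Y_def)
    also have "norm \<dots> \<le> 1 * norm ?Z"
      using Finite_Cartesian_Product.norm_nth_le[of "?Z $ i" j] Finite_Cartesian_Product.norm_nth_le[of ?Z i]
      by simp
    finally show "norm (Y i j n \<omega> - \<sigma>\<^sup>2 * A $ i $ j) \<le> 1 * norm ?Z" .
  qed
  \<comment> \<open>The zero-based positions of lags 1 and 3; the bounds on \<open>D\<close> and
    \<open>L\<close> place both inside the feature vector.\<close>
  have "nat (1 - D) < CARD('m)" "nat (3 - D) < CARD('m)"
    using lags dim by linarith+
  then obtain p q :: 'm where pq: "card {..<p} = nat (1 - D)" "card {..<q} = nat (3 - D)"
    using ex_card_lessThan by meson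
  \<comment> \<open>Half of the least nonzero entry of \<open>\<sigma>\<^sup>2 *\<^sub>R A\<close>,
    capped by inserting 1, which keeps the minimum defined when \<open>A\<close> is zero. The
    minimum runs over all nodes, so one threshold serves every pair.\<close>
  define \<tau> where "\<tau> = Min (insert 1 {\<sigma>\<^sup>2 * A $ i $ j |i j. A $ i $ j \<noteq> 0}) / 2"
  have fin: "finite {\<sigma>\<^sup>2 * A $ i $ j |i j. A $ i $ j \<noteq> 0}"
    by (rule finite_subset[of _ "range (\<lambda>(i, j). \<sigma>\<^sup>2 * A $ i $ j)"]) auto
  have pos: "0 < \<sigma>\<^sup>2 * A $ i $ j" if "A $ i $ j \<noteq> 0" for i j
    using sigma nonneg[of i j] that by simp
  have "0 < Min (insert 1 {\<sigma>\<^sup>2 * A $ i $ j |i j. A $ i $ j \<noteq> 0})"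
    using fin by (subst Min_gr_iff) (auto simp: pos)
  hence \<tau>0: "0 < \<tau>" by (simp add: \<tau>_def)
  have \<tau>: "\<tau> < \<sigma>\<^sup>2 * A $ i $ j" if "A $ i $ j \<noteq> 0" for i j
  proof -
    have "Min (insert 1 {\<sigma>\<^sup>2 * A $ i $ j |i j. A $ i $ j \<noteq> 0}) \<le> \<sigma>\<^sup>2 * A $ i $ j"
      using fin that by (intro Min_le) auto
    thus ?thesis using \<tau>0 unfolding \<tau>_def by linarith
  qed
  define f :: "(real, 'm) vec \<Rightarrow> real" where "f t = t $ p - t $ q - \<tau>" for t
  have "linear (\<lambda>t :: (real, 'm) vec. t $ p - t $ q)"
    by (rule linearI) (simp_all add: algebra_simps)
  hence "affine_map f"
    unfolding affine_map_def by (intro exI[of _ "\<lambda>t. t $ p - t $ q"] exI[of _ "- \<tau>"]) (simp add: f_def)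
  moreover have f: "f (feature D (\<lambda>l. y l \<omega>) n i j) = Y i j n \<omega> - \<tau>" for n i j \<omega>
    using lags(1) by (simp add: f_def feature_def pq Y_def)
  have "(\<lambda>n. prob {\<omega> \<in> space M. f (feature D (\<lambda>l. y l \<omega>) n i j) > 0}) \<longlonglongrightarrow> 1"
    if "A $ i $ j \<noteq> 0" for i j
  proof (rule prob_tendsto_1_if_vanishes_in_prob[OF Y_lim[of i j]])
    \<comment> \<open>Half of the gap between limit and threshold as tolerance leaves a strict
      inequality.\<close>
    show "0 < (\<sigma>\<^sup>2 * A $ i $ j - \<tau>) / 2" using \<tau>[OF that] by simp
    show "\<omega> \<in> {\<omega> \<in> space M. f (feature D (\<lambda>l. y l \<omega>) n i j) > 0}"
      if "\<omega> \<in> space M" "norm (Y i j n \<omega> - \<sigma>\<^sup>2 * A $ i $ j) \<le> (\<sigma>\<^sup>2 * A $ i $ j - \<tau>) / 2" for n \<omega>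
    proof -
      have "\<tau> < Y i j n \<omega>"
        using abs_le_D2[OF that(2)[unfolded real_norm_def]] \<tau>[OF \<open>A $ i $ j \<noteq> 0\<close>]
        by (simp only: minus_diff_eq) (simp add: diff_divide_distrib)
      thus ?thesis using that(1) by (simp add: f)
    qed
  qed (simp add: f)
  moreover have "(\<lambda>n. prob {\<omega> \<in> space M. f (feature D (\<lambda>l. y l \<omega>) n i j) \<le> 0}) \<longlonglongrightarrow> 1"
    if "A $ i $ j = 0" for i j
    \<comment> \<open>The limit is zero here, and since the target inequality is not strict, the
      tolerance may be \<open>\<tau>\<close> itself.\<close>
    by (rule prob_tendsto_1_if_vanishes_in_prob[OF Y_lim[of i j] \<tau>0]) (simp_all add: f that)
  ultimately show ?thesis by blast
qed

end
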